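(* Let $A$ be an $\ell\cdot n\times d$ real matrix, let $c:[\ell\cdot n]\rightarrow[\ell]$ be a balanced coloring of the rows of $A$, let $k$ be an integer, and let $p,q\ge 1$. Suppose there is an $\alpha$-approximation algorithm for the unconstrained $(k,p,q)$-clustering problem whose running time on an $n$-point instance is $T(n,d,k,p,q)$. Then there exists an $(\alpha+2)$-approximation algorithm for the fair $(k,p,q)$-clustering problem with $\ell$ colors, running in time $O(\ell^2\cdot MCPM(n)\cdot T(n,d,k,p,q))$.
   Context: Rows of a matrix are points in $\mathbb{R}^d$. For a matrix $M$ with $N$ rows, the cascaded norm is $\|M\|_{p,q}=\left(\sum_{i=1}^N\left(\sum_{j=1}^d|M_{i,j}|^q\right)^{p/q}\right)^{1/p}$. Given a point matrix $A$ with $N$ rows, the (unconstrained) $(k,p,q)$-clustering problem asks for an $N\times d$ matrix $C$ with at most $k$ distinct rows minimizing $\|A-C\|_{p,q}$; the cluster induced by a row $C_j$ is $\{A_i : C_i=C_j\}$. An $\alpha$-approximation algorithm outputs a feasible $C$ of cost at most $\alpha$ times the optimum. A coloring $c:[\ell n]\to[\ell]$ is balanced if each color class has exactly $n$ points; a set $S$ of points is balanced if it contains the same number of points of every color. The fair $(k,p,q)$-clustering problem is the same as the $(k,p,q)$-clustering problem with the additional requirement that every cluster induced by $C$ is balanced. For two $n$-point sets $X,Y$, a perfect matching is a bijection $\pi:X\to Y$ with $(p,q)$-cost $\left(\sum_{x\in X}\|x-\pi(x)\|_q^p\right)^{1/p}$; $MCPM(n)$ denotes the time needed to compute a minimum $(p,q)$-cost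 perfect matching between two $n$-point sets. *)

theory Defs
  imports Complex_Main "HOL-Library.FuncSet" "Jordan_Normal_Form.Matrix"
begin

section \<open>Clustering, fairness and matchings\<close>

definition cascaded_norm :: "real \<Rightarrow> real \<Rightarrow> real mat \<Rightarrow> real" where
  "cascaded_norm p q M =
     (\<Sum>i<dim_row M. (\<Sum>j<dim_col M. \<bar>M $$ (i, j)\<bar> powr q) powr (p / q)) powr (1 / p)"

definition clusterings :: "nat \<Rightarrow> nat \<Rightarrow> nat \<Rightarrow> real mat set" where
  "clusterings k N d = {C \<in> carrier_mat N d. card (set (rows C)) \<le> k}"

text \<open>A cluster is a set of row indices, so that coinciding input points are
  counted with multiplicity.\<close>

definition cluster :: "real mat \<Rightarrow> nat \<Rightarrow> nat set" where
  "cluster C j = {i. i < dim_row C \<and> row C i = row C j}"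

text \<open>Rows are indexed from \<open>0\<close>, and the \<open>l\<close> colors are \<open>0, \<dots>, l - 1\<close>.\<close>

definition balanced_coloring :: "nat \<Rightarrow> nat \<Rightarrow> (nat \<Rightarrow> nat) \<Rightarrow> bool" where
  "balanced_coloring l n c \<longleftrightarrow>
     c \<in> {..<l * n} \<rightarrow> {..<l} \<and> (\<forall>a<l. card {i. i < l * n \<and> c i = a} = n)"

definition balanced_set :: "nat \<Rightarrow> (nat \<Rightarrow> nat) \<Rightarrow> nat set \<Rightarrow> bool" where
  "balanced_set l c S \<longleftrightarrow> (\<forall>a<l. \<forall>b<l. card {i \<in> S. c i = a} = card {i \<in> S. c i = b})"

definition fair_clusterings ::
    "nat \<Rightarrow> nat \<Rightarrow> nat \<Rightarrow> nat \<Rightarrow> (nat \<Rightarrow> nat) \<Rightarrow> real mat set" where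
  "fair_clusterings k l n d c =
     {C \<in> clusterings k (l * n) d. \<forall>j<l * n. balanced_set l c (cluster C j)}"

definition approx_optimal :: "real \<Rightarrow> ('c \<Rightarrow> real) \<Rightarrow> 'c set \<Rightarrow> 'c \<Rightarrow> bool" where
  "approx_optimal \<alpha> cost F C \<longleftrightarrow> C \<in> F \<and> cost C \<le> \<alpha> * (INF C'\<in>F. cost C')"

definition lq_norm :: "real \<Rightarrow> real vec \<Rightarrow> real" where
  "lq_norm q v = (\<Sum>j<dim_vec v. \<bar>v $ j\<bar> powr q) powr (1 / q)"

text \<open>A perfect matching between the rows of \<open>X\<close> and the rows of \<open>Y\<close> is a
  bijection between the row indices.\<close>

definition perfect_matchings :: "nat \<Rightarrow> (nat \<Rightarrow> nat) set" where
  "perfect_matchings n = {\<pi>. bij_betw \<pi> {..<n} {..<n}}"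

definition matching_cost ::
    "real \<Rightarrow> real \<Rightarrow> real mat \<Rightarrow> real mat \<Rightarrow> (nat \<Rightarrow> nat) \<Rightarrow> real" where
  "matching_cost p q X Y \<pi> =
     (\<Sum>i<dim_row X. lq_norm q (row X i - row Y (\<pi> i)) powr p) powr (1 / p)"

definition min_cost_matching ::
    "nat \<Rightarrow> real \<Rightarrow> real \<Rightarrow> real mat \<Rightarrow> real mat \<Rightarrow> (nat \<Rightarrow> nat) \<Rightarrow> bool" where
  "min_cost_matching n p q X Y \<pi> \<longleftrightarrow> \<pi> \<in> perfect_matchings n \<and>
     (\<forall>\<sigma>\<in>perfect_matchings n. matching_cost p q X Y \<pi> \<le> matching_cost p q X Y \<sigma>)"


section \<open>Programs on a real RAM\<close>

text \<open>Algorithms are programs of a structured real random access machine.  The memory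
  consists of natural-number arrays and real arrays; arrays are named by numbers,
  are unbounded, and are initially zero.  Scalars are stored in array cells, and
  array indices are computed at run time (indirect addressing).  Programs contain
  no real constants and cannot round a real to an integer; real powers are a
  primitive because the objective functions are built from them.
  Every operation, memory access and test costs one step.\<close>

datatype nexp =
    NConst nat
  | NGet nat nexp
  | NAdd nexp nexp
  | NSub nexp nexp
  | NMul nexp nexp

datatype rexp =
    RNat nexp
  | RGet nat nexp
  | RAdd rexp rexp
  | RSub rexp rexp
  | RMul rexp rexp
  | RDiv rexp rexp
  | RPow rexp rexp
  | RAbs rexp

datatype bexp =
    NLess nexp nexp
  | RLess rexp rexp
  | BNot bexp
  | BAnd bexp bexp

text \<open>\<open>Call P x e y f u g v h\<close> runs \<open>P\<close> as a subroutine on fresh private memory.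
  Its input is the first \<open>e\<close> cells of the natural-number array \<open>x\<close> and the first
  \<open>f\<close> cells of the real array \<open>y\<close>; the first \<open>g\<close> natural-number and the first \<open>h\<close> real
  output cells are copied back to the arrays \<open>u\<close> and \<open>v\<close>.\<close>

datatype com =
    Skip
  | NSet nat nexp nexp
  | RSet nat nexp rexp
  | Seq com com
  | If bexp com com
  | While bexp com
  | Call com nat nexp nat nexp nat nexp nat nexp

record mem =
  nats :: "nat \<Rightarrow> nat \<Rightarrow> nat"
  reals :: "nat \<Rightarrow> nat \<Rightarrow> real"

primrec neval :: "nexp \<Rightarrow> mem \<Rightarrow> nat" where
  "neval (NConst m) s = m"
| "neval (NGet x e) s = nats s x (neval e s)"
| "neval (NAdd e f) s = neval e s + neval f s"
| "neval (NSub e f) s = neval e s - neval f s"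
| "neval (NMul e f) s = neval e s * neval f s"

primrec reval :: "rexp \<Rightarrow> mem \<Rightarrow> real" where
  "reval (RNat e) s = real (neval e s)"
| "reval (RGet x e) s = reals s x (neval e s)"
| "reval (RAdd e f) s = reval e s + reval f s"
| "reval (RSub e f) s = reval e s - reval f s"
| "reval (RMul e f) s = reval e s * reval f s"
| "reval (RDiv e f) s = reval e s / reval f s"
| "reval (RPow e f) s = reval e s powr reval f s"
| "reval (RAbs e) s = \<bar>reval e s\<bar>"

primrec beval :: "bexp \<Rightarrow> mem \<Rightarrow> bool" where
  "beval (NLess e f) s \<longleftrightarrow> neval e s < neval f s"
| "beval (RLess e f) s \<longleftrightarrow> reval e s < reval f s"
| "beval (BNot b) s \<longleftrightarrow> \<not> beval b s"
| "beval (BAnd b c) s \<longleftrightarrow> beval b s \<and> beval c s"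

primrec ncost :: "nexp \<Rightarrow> nat" where
  "ncost (NConst m) = 1"
| "ncost (NGet x e) = 1 + ncost e"
| "ncost (NAdd e f) = 1 + ncost e + ncost f"
| "ncost (NSub e f) = 1 + ncost e + ncost f"
| "ncost (NMul e f) = 1 + ncost e + ncost f"

primrec rcost :: "rexp \<Rightarrow> nat" where
  "rcost (RNat e) = 1 + ncost e"
| "rcost (RGet x e) = 1 + ncost e"
| "rcost (RAdd e f) = 1 + rcost e + rcost f"
| "rcost (RSub e f) = 1 + rcost e + rcost f"
| "rcost (RMul e f) = 1 + rcost e + rcost f"
| "rcost (RDiv e f) = 1 + rcost e + rcost f"
| "rcost (RPow e f) = 1 + rcost e + rcost f"
| "rcost (RAbs e) = 1 + rcost e"

primrec bcost :: "bexp \<Rightarrow> nat" where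
  "bcost (NLess e f) = 1 + ncost e + ncost f"
| "bcost (RLess e f) = 1 + rcost e + rcost f"
| "bcost (BNot b) = 1 + bcost b"
| "bcost (BAnd b c) = 1 + bcost b + bcost c"

definition set_nat :: "nat \<Rightarrow> nat \<Rightarrow> nat \<Rightarrow> mem \<Rightarrow> mem" where
  "set_nat x i a s = s\<lparr>nats := (nats s)(x := (nats s x)(i := a))\<rparr>"

definition set_real :: "nat \<Rightarrow> nat \<Rightarrow> real \<Rightarrow> mem \<Rightarrow> mem" where
  "set_real x i a s = s\<lparr>reals := (reals s)(x := (reals s x)(i := a))\<rparr>"

text \<open>Array \<open>0\<close> of each kind holds the input and array \<open>1\<close> of each kind the output.\<close>

definition load :: "nat list \<Rightarrow> real list \<Rightarrow> mem" where
  "load ns rs =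
     \<lparr>nats = (\<lambda>x i. if x = 0 \<and> i < length ns then ns ! i else 0),
      reals = (\<lambda>x i. if x = 0 \<and> i < length rs then rs ! i else 0)\<rparr>"

abbreviation nat_output :: "mem \<Rightarrow> nat \<Rightarrow> nat" where
  "nat_output s \<equiv> nats s 1"

abbreviation real_output :: "mem \<Rightarrow> nat \<Rightarrow> real" where
  "real_output s \<equiv> reals s 1"

definition copy_back :: "nat \<Rightarrow> nat \<Rightarrow> nat \<Rightarrow> nat \<Rightarrow> mem \<Rightarrow> mem \<Rightarrow> mem" where
  "copy_back u g v h r s =
     \<lparr>nats = (nats s)(u := (\<lambda>i. if i < g then nat_output r i else nats s u i)),
      reals = (reals s)(v := (\<lambda>i. if i < h then real_output r i else reals s v i))\<rparr>"

text \<open>\<open>exec P s t s'\<close>: started in memory \<open>s\<close>, the program \<open>P\<close> halts in memory \<open>s'\<close> after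
  exactly \<open>t\<close> steps.  A subroutine call is charged for copying its input and output.\<close>

inductive exec :: "com \<Rightarrow> mem \<Rightarrow> nat \<Rightarrow> mem \<Rightarrow> bool" where
  Skip: "exec Skip s 1 s"
| NSet: "exec (NSet x e f) s (1 + ncost e + ncost f) (set_nat x (neval e s) (neval f s) s)"
| RSet: "exec (RSet x e f) s (1 + ncost e + rcost f) (set_real x (neval e s) (reval f s) s)"
| Seq: "exec P s t s' \<Longrightarrow> exec Q s' t' s'' \<Longrightarrow> exec (Seq P Q) s (t + t') s''"
| IfTrue: "beval b s \<Longrightarrow> exec P s t s' \<Longrightarrow> exec (If b P Q) s (1 + bcost b + t) s'"
| IfFalse: "\<not> beval b s \<Longrightarrow> exec Q s t s' \<Longrightarrow> exec (If b P Q) s (1 + bcost b + t) s'"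
| WhileFalse: "\<not> beval b s \<Longrightarrow> exec (While b P) s (1 + bcost b) s"
| WhileTrue: "beval b s \<Longrightarrow> exec P s t s' \<Longrightarrow> exec (While b P) s' t' s'' \<Longrightarrow>
    exec (While b P) s (1 + bcost b + t + t') s''"
| Call: "exec P (load (map (nats s x) [0..<neval e s]) (map (reals s y) [0..<neval f s])) t r \<Longrightarrow>
    exec (Call P x e y f u g v h) s
      (1 + ncost e + ncost f + ncost g + ncost h
         + neval e s + neval f s + t + neval g s + neval h s)
      (copy_back u (neval g s) v (neval h s) r s)"

text \<open>The running time on an input includes one step for reading each input number.\<close>

definition halts_within :: "com \<Rightarrow> nat list \<Rightarrow> real list \<Rightarrow> real \<Rightarrow> mem \<Rightarrow> bool" where
  "halts_within P ns rs B r \<longleftrightarrow>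
     (\<exists>t. exec P (load ns rs) t r \<and> real (length ns + length rs + t) \<le> B)"


section \<open>Algorithms for the three problems\<close>

text \<open>Matrices are read and written in row-major order.\<close>

definition encode_mat :: "real mat \<Rightarrow> real list" where
  "encode_mat A = concat (mat_to_list A)"

definition decode_mat :: "nat \<Rightarrow> nat \<Rightarrow> (nat \<Rightarrow> real) \<Rightarrow> real mat" where
  "decode_mat N d f = mat N d (\<lambda>(i, j). f (i * d + j))"

definition clustering_algorithm ::
    "com \<Rightarrow> real \<Rightarrow> nat \<Rightarrow> real \<Rightarrow> real \<Rightarrow> (nat \<Rightarrow> nat \<Rightarrow> real) \<Rightarrow> bool" where
  "clustering_algorithm P \<alpha> k p q B \<longleftrightarrow>
     (\<forall>n\<ge>1. \<forall>d\<ge>1. \<forall>A\<in>carrier_mat n d.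
        \<exists>r. halts_within P [n, d, k] ([p, q] @ encode_mat A) (B n d) r \<and>
          approx_optimal \<alpha> (\<lambda>C. cascaded_norm p q (A - C)) (clusterings k n d)
            (decode_mat n d (real_output r)))"

definition fair_clustering_algorithm ::
    "com \<Rightarrow> real \<Rightarrow> nat \<Rightarrow> real \<Rightarrow> real \<Rightarrow> (nat \<Rightarrow> nat \<Rightarrow> nat \<Rightarrow> real) \<Rightarrow> bool" where
  "fair_clustering_algorithm P \<alpha> k p q B \<longleftrightarrow>
     (\<forall>l\<ge>1. \<forall>n\<ge>1. \<forall>d\<ge>1. \<forall>A\<in>carrier_mat (l * n) d. \<forall>c. balanced_coloring l n c \<longrightarrow>
        (\<exists>r. halts_within P ([l, n, d, k] @ map c [0..<l * n]) ([p, q] @ encode_mat A) (B l n d) r \<and>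
          approx_optimal \<alpha> (\<lambda>C. cascaded_norm p q (A - C)) (fair_clusterings k l n d c)
            (decode_mat (l * n) d (real_output r))))"

definition matching_algorithm ::
    "com \<Rightarrow> real \<Rightarrow> real \<Rightarrow> (nat \<Rightarrow> nat \<Rightarrow> real) \<Rightarrow> bool" where
  "matching_algorithm P p q B \<longleftrightarrow>
     (\<forall>n\<ge>1. \<forall>d\<ge>1. \<forall>X\<in>carrier_mat n d. \<forall>Y\<in>carrier_mat n d.
        \<exists>r. halts_within P [n, d] ([p, q] @ encode_mat X @ encode_mat Y) (B n d) r \<and>
          min_cost_matching n p q X Y (nat_output r))"

end

theory Submission
  imports Defs "HOL-Analysis.Convex" "HOL-Combinatorics.Permutations"
begin

text \<open>For each color \<open>i\<close>, cluster the color class \<open>A\<^sub>i\<close> by \<open>U\<close>, match it with every color class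
  \<open>A\<^sub>j\<close> by \<open>M\<close>, and give each point of \<open>A\<^sub>j\<close> the center of its partner; the best of these \<open>l\<close>
  candidates is returned.  They are fair because every cluster is a union of matched groups.
  Let \<open>G\<close> be a fair clustering and \<open>D\<^sub>i\<close> its cost on \<open>A\<^sub>i\<close>.  Balancedness provides a matching of
  \<open>A\<^sub>i\<close> with \<open>A\<^sub>j\<close> inside the clusters of \<open>G\<close>, so an optimal matching costs at most \<open>D\<^sub>i + D\<^sub>j\<close>, and by
  Minkowski's inequality candidate \<open>i\<close> costs at most
  \<open>(\<alpha> + 1) l\<^bsup>1/p\<^esup> D\<^sub>i + \<parallel>A - G\<parallel>\<close>.  For the color with the least \<open>D\<^sub>i\<close> one has
  \<open>l\<^bsup>1/p\<^esup> D\<^sub>i \<le> \<parallel>A - G\<parallel>\<close>.  The overhead is absorbed by the product of the two running times because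
  both subroutines have to read their inputs.\<close>

section \<open>Minkowski's inequality and distances of rows\<close>

text \<open>The color with the least \<open>D\<^sub>i\<close> is defined through an unknown fair
  optimum, so an algorithm cannot tell which one it is. This is why every color serves as pivot and
  is matched with every color, which costs the factor \<open>l ^ 2\<close>. Every fair clustering is
  compared with its own cheap pivot, and the infimum is taken only afterwards; so no optimal fair
  clustering has to exist. Scaling the bound for the pivot class by \<alpha> requires \<alpha> \<ge>
  0. This is no hypothesis of the theorem, but follows from the existence of the approximation
  algorithm. The machine model shapes the second half. A subroutine expects its points in
  consecutive cells, so the rows are sorted by color before the first call and put back in their
  original places on output. About the running times of the subroutines only upper bounds are known,
  and these bound the sizes of the inputs in turn; hence the product of the two bounds is the unit
  in which all other work is measured.\<close>

definition lp_norm :: "real \<Rightarrow> 'a set \<Rightarrow> ('a \<Rightarrow> real) \<Rightarrow> real" where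
  "lp_norm p I f = (\<Sum>i\<in>I. \<bar>f i\<bar> powr p) powr (1 / p)"

lemma lp_norm_nonneg [simp]: "lp_norm p I f \<ge> 0"
  by (simp add: lp_norm_def)

lemma lp_norm_powr: "p \<noteq> 0 \<Longrightarrow> lp_norm p I f powr p = (\<Sum>i\<in>I. \<bar>f i\<bar> powr p)"
  by (simp add: lp_norm_def powr_powr sum_nonneg)

lemma lp_norm_cong: "(\<And>i. i \<in> I \<Longrightarrow> \<bar>f i\<bar> = \<bar>g i\<bar>) \<Longrightarrow> lp_norm p I f = lp_norm p I g"
  by (simp add: lp_norm_def)

lemma lp_norm_mono:
  assumes "p \<ge> 1" "\<And>i. i \<in> I \<Longrightarrow> \<bar>f i\<bar> \<le> \<bar>g i\<bar>"
  shows "lp_norm p I f \<le> lp_norm p I g"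
  unfolding lp_norm_def using assms by (intro powr_mono2 sum_mono sum_nonneg) auto

lemma lp_norm_reindex: "bij_betw h J I \<Longrightarrow> lp_norm p I f = lp_norm p J (\<lambda>j. f (h j))"
  unfolding lp_norm_def by (simp add: sum.reindex_bij_betw[of h J I "\<lambda>i. \<bar>f i\<bar> powr p"])

text \<open>With the same exponent inside and outside, the inner root cancels. This lets the cost of
  a clustering be split along color blocks.\<close>

lemma lp_norm_Times:
  assumes "p \<noteq> 0"
  shows "lp_norm p (I \<times> J) f = lp_norm p I (\<lambda>i. lp_norm p J (\<lambda>j. f (i, j)))"
  using assms lp_norm_powr[OF assms, of J]
  by (simp add: lp_norm_def[of p I] lp_norm_def[of p "I \<times> J"] sum.cartesian_product)

lemma lp_norm_const: "p \<noteq> 0 \<Longrightarrow> lp_norm p I (\<lambda>i. b) = real (card I) powr (1 / p) * \<bar>b\<bar>"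
  by (simp add: lp_norm_def powr_mult powr_powr)

text \<open>Convexity settles positive arguments. If one argument is zero, the claim reduces to s^p
  \<le> s for s between 0 and 1.\<close>

lemma powr_convex_combination:
  fixes t x y p :: real
  assumes "p \<ge> 1" "0 \<le> t" "t \<le> 1" "x \<ge> 0" "y \<ge> 0"
  shows "((1 - t) * x + t * y) powr p \<le> (1 - t) * x powr p + t * y powr p"
proof -
  have shrink: "(s * z) powr p \<le> s * z powr p" if "0 \<le> s" "s \<le> 1" "z \<ge> 0" for s z :: real
    using powr_mono'[of 1 p s] that assms(1)
    by (auto simp: powr_mult intro!: mult_right_mono)
  consider "x = 0" | "y = 0" | "x > 0" "y > 0" using assms by linarith
  then show ?thesis
  proof cases
    case 3
    then show ?thesis
      using convex_onD[OF powr_convex[OF assms(1)], of t x y] assms by simp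
  qed (use shrink[of t y] shrink[of "1 - t" x] assms in auto)
qed

lemma lp_norm_eq_0:
  assumes "finite I" "lp_norm p I f = 0" "i \<in> I"
  shows "f i = 0"
  using assms by (simp add: lp_norm_def sum_nonneg_eq_0_iff)

text \<open>After division by their norms \<open>a\<close> and \<open>b\<close>, both functions have
  norm 1, and \<open>(\<bar>f\<bar> + \<bar>g\<bar>) / (a + b)\<close> is their convex combination
  with weight \<open>t = b / (a + b)\<close>; convexity is then applied pointwise and summed. A
  function of norm zero vanishes on \<open>I\<close> and is treated apart.\<close>

lemma lp_norm_triangle:
  assumes "p \<ge> 1" "finite I"
  shows "lp_norm p I (\<lambda>i. f i + g i) \<le> lp_norm p I f + lp_norm p I g"
proof -
  define a b where "a = lp_norm p I f" and "b = lp_norm p I g"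
  have ab: "a \<ge> 0" "b \<ge> 0" by (simp_all add: a_def b_def)
  consider "a = 0" | "b = 0" | "a > 0" "b > 0" using ab by linarith
  then have "lp_norm p I (\<lambda>i. f i + g i) \<le> a + b"
  proof cases
    case 1
    then have "lp_norm p I (\<lambda>i. f i + g i) = b"
      unfolding b_def by (intro lp_norm_cong) (simp add: a_def lp_norm_eq_0[OF assms(2)])
    then show ?thesis using ab by simp
  next
    case 2
    then have "lp_norm p I (\<lambda>i. f i + g i) = a"
      unfolding a_def by (intro lp_norm_cong) (simp add: b_def lp_norm_eq_0[OF assms(2)])
    then show ?thesis using ab by simp
  next
    case 3
    define t where "t = b / (a + b)"
    have t: "0 \<le> t" "t \<le> 1" "1 - t = a / (a + b)"
      using 3 by (auto simp: t_def field_simps)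
    have pa: "(\<Sum>i\<in>I. \<bar>f i\<bar> powr p) = a powr p" and pb: "(\<Sum>i\<in>I. \<bar>g i\<bar> powr p) = b powr p"
      using assms lp_norm_powr[of p I] by (simp_all add: a_def b_def)
    have step: "\<bar>f i + g i\<bar> powr p \<le>
        (a + b) powr p * ((1 - t) * (\<bar>f i\<bar> powr p / a powr p) + t * (\<bar>g i\<bar> powr p / b powr p))" for i
    proof -
      have "\<bar>f i + g i\<bar> \<le> \<bar>f i\<bar> + \<bar>g i\<bar>" by simp
      also have "\<dots> = (a + b) * ((1 - t) * (\<bar>f i\<bar> / a) + t * (\<bar>g i\<bar> / b))"
        unfolding t(3) unfolding t_def distrib_left using 3 by simp
      finally have "\<bar>f i + g i\<bar> powr p \<le> ((a + b) * ((1 - t) * (\<bar>f i\<bar> / a) + t * (\<bar>g i\<bar> / b))) powr p"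
        using assms by (intro powr_mono2) auto
      also have "\<dots> = (a + b) powr p * ((1 - t) * (\<bar>f i\<bar> / a) + t * (\<bar>g i\<bar> / b)) powr p"
        using t 3 by (simp add: powr_mult)
      also have "\<dots> \<le> (a + b) powr p * ((1 - t) * (\<bar>f i\<bar> / a) powr p + t * (\<bar>g i\<bar> / b) powr p)"
        using t 3 assms by (intro mult_left_mono powr_convex_combination) auto
      also have "\<dots> = (a + b) powr p * ((1 - t) * (\<bar>f i\<bar> powr p / a powr p) + t * (\<bar>g i\<bar> powr p / b powr p))"
        using 3 by (simp add: powr_divide)
      finally show ?thesis .
    qed
    have "(\<Sum>i\<in>I. \<bar>f i + g i\<bar> powr p) \<le> (\<Sum>i\<in>I.
        (a + b) powr p * ((1 - t) * (\<bar>f i\<bar> powr p / a powr p) + t * (\<bar>g i\<bar> powr p / b powr p)))"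
      by (intro sum_mono step)
    also have "\<dots> = (a + b) powr p * ((1 - t) * ((\<Sum>i\<in>I. \<bar>f i\<bar> powr p) / a powr p)
        + t * ((\<Sum>i\<in>I. \<bar>g i\<bar> powr p) / b powr p))"
      by (simp add: sum.distrib flip: sum_distrib_left sum_divide_distrib times_divide_eq_right)
    also have "\<dots> = (a + b) powr p" using 3 unfolding pa pb by simp
    finally have "lp_norm p I (\<lambda>i. f i + g i) \<le> ((a + b) powr p) powr (1 / p)"
      unfolding lp_norm_def using assms by (intro powr_mono2 sum_nonneg) auto
    also have "\<dots> = a + b" using assms 3 by (simp add: powr_powr)
    finally show ?thesis .
  qed
  then show ?thesis by (simp add: a_def b_def)
qed

text \<open>Common form of the inner norm of \<open>cascaded_norm\<close> and of the point distance
  in \<open>matching_cost\<close>; both costs become an \<open>lp_norm\<close> of such distances.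
  The width is taken from \<open>X\<close>, hence the conditions on \<open>dim_col\<close>
  below.\<close>

definition row_dist :: "real \<Rightarrow> real mat \<Rightarrow> nat \<Rightarrow> real mat \<Rightarrow> nat \<Rightarrow> real" where
  "row_dist q X i Y j = lp_norm q {..<dim_col X} (\<lambda>e. X $$ (i, e) - Y $$ (j, e))"

lemma row_dist_nonneg [simp]: "row_dist q X i Y j \<ge> 0"
  by (simp add: row_dist_def)

lemma row_dist_triangle:
  assumes "q \<ge> 1" "dim_col X = dim_col Y"
  shows "row_dist q X i Z j \<le> row_dist q X i Y m + row_dist q Y m Z j"
  using lp_norm_triangle[of q "{..<dim_col Y}" "\<lambda>e. X $$ (i, e) - Y $$ (m, e)" "\<lambda>e. Y $$ (m, e) - Z $$ (j, e)"]
    assms by (simp add: row_dist_def)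

lemma row_dist_commute:
  assumes "dim_col X = dim_col Y"
  shows "row_dist q X i Y j = row_dist q Y j X i"
  unfolding row_dist_def using assms by (auto intro: lp_norm_cong)

lemma cascaded_norm_diff:
  assumes "p \<ge> 1" "q \<ge> 1" "X \<in> carrier_mat N d" "Y \<in> carrier_mat N d"
  shows "cascaded_norm p q (X - Y) = lp_norm p {..<N} (\<lambda>i. row_dist q X i Y i)"
proof -
  have "lp_norm q J f powr p = (\<Sum>j\<in>J. \<bar>f j\<bar> powr q) powr (p / q)" for f :: "nat \<Rightarrow> real" and J
    by (simp add: lp_norm_def powr_powr)
  then show ?thesis
    using assms by (simp add: cascaded_norm_def lp_norm_def[of p] row_dist_def)
qed

lemma matching_cost_row_dist:
  assumes "X \<in> carrier_mat n d" "Y \<in> carrier_mat n d" "\<pi> \<in> perfect_matchings n"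
  shows "matching_cost p q X Y \<pi> = lp_norm p {..<n} (\<lambda>i. row_dist q X i Y (\<pi> i))"
proof -
  have "\<pi> i < n" if "i < n" for i
    using assms that by (auto simp: perfect_matchings_def bij_betw_def)
  then have "lq_norm q (row X i - row Y (\<pi> i)) = row_dist q X i Y (\<pi> i)" if "i < n" for i
    using assms that by (auto simp: lq_norm_def row_dist_def lp_norm_def)
  then show ?thesis
    using assms by (simp add: matching_cost_def lp_norm_def[of p])
qed

section \<open>Transporting a clustering along matchings\<close>

lemma bij_betw_block_index:
  "bij_betw (\<lambda>(a, t). a * n + t) ({..<l} \<times> {..<n}) {..<l * n :: nat}"
proof (rule bij_betw_byWitness[where f' = "\<lambda>r. (r div n, r mod n)"])
  show "(\<lambda>(a, t). a * n + t) ` ({..<l} \<times> {..<n}) \<subseteq> {..<l * n}"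
  proof (clarsimp)
    fix a t assume "a < l" "t < n"
    then have "a * n + t < Suc a * n" "Suc a * n \<le> l * n"
      by (simp, intro mult_le_mono) auto
    then show "a * n + t < l * n" by simp
  qed
  show "(\<lambda>r. (r div n, r mod n)) ` {..<l * n} \<subseteq> {..<l} \<times> {..<n}"
    by (cases "n = 0") (auto simp: less_mult_imp_div_less)
qed auto

lemma block_index_less: "a < l \<Longrightarrow> t < n \<Longrightarrow> a * n + t < (l * n :: nat)"
  using bij_betw_block_index[of n l] by (auto simp: bij_betw_def)

text \<open>Equal fibre sizes mean equal multisets of values, and functions with the same multiset
  of values differ by a permutation of the domain. This is the source of the matching inside the
  clusters.\<close>

lemma equal_fibres_imp_bij:
  assumes "\<And>v. card {t. t < n \<and> f t = v} = card {t. t < (n::nat) \<and> g t = v}"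
  obtains \<sigma> where "bij_betw \<sigma> {..<n} {..<n}" "\<And>t. t < n \<Longrightarrow> f t = g (\<sigma> t)"
proof -
  have count: "count (image_mset h (mset_set {..<n})) v = card {t. t < n \<and> h t = v}" for h :: "nat \<Rightarrow> 'a" and v
    by (simp add: count_image_mset' eq_commute)
  have "image_mset f (mset_set {..<n}) = image_mset g (mset_set {..<n})"
    by (rule multiset_eqI) (simp add: count assms)
  then obtain \<sigma> where "\<sigma> permutes {..<n}" "\<forall>t\<in>{..<n}. f t = g (\<sigma> t)"
    using image_mset_eq_implies_permutes[of "{..<n}" f g] by auto
  then show ?thesis using that permutes_imp_bij by auto
qed

section \<open>Rows ordered by color\<close>

definition color_class :: "real mat \<Rightarrow> (nat \<Rightarrow> nat) \<Rightarrow> nat \<Rightarrow> nat \<Rightarrow> real mat" where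
  "color_class A pos n a = mat n (dim_col A) (\<lambda>(t, e). A $$ (pos (a * n + t), e))"

lemma color_class_carrier: "A \<in> carrier_mat N d \<Longrightarrow> color_class A pos n a \<in> carrier_mat n d"
  by (simp add: color_class_def)

lemma row_dist_color_class:
  assumes "t < n" "u < n" "dim_col A = dim_col B"
  shows "row_dist q (color_class A pos n a) t (color_class B pos n b) u =
    row_dist q A (pos (a * n + t)) B (pos (b * n + u))"
  unfolding row_dist_def using assms by (auto simp: color_class_def intro: lp_norm_cong)

text \<open>The approximation argument needs no more than some order \<open>pos\<close> of the rows
  in which color \<open>a\<close> occupies block \<open>a\<close> of length \<open>n\<close>.
  Abstracting from the order lets the content of an array computed by the program be inserted
  later.\<close>

locale color_sorting =
  fixes l n :: nat and c pos :: "nat \<Rightarrow> nat"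
  assumes l_pos: "l \<ge> 1"
    and pos_bij: "bij_betw pos {..<l * n} {..<l * n}"
    and color_pos: "\<And>a t. a < l \<Longrightarrow> t < n \<Longrightarrow> c (pos (a * n + t)) = a"
begin

lemma pos_block_bij: "bij_betw (\<lambda>(a, t). pos (a * n + t)) ({..<l} \<times> {..<n}) {..<l * n}"
  using bij_betw_trans[OF bij_betw_block_index pos_bij] by (simp add: comp_def case_prod_unfold)

lemma pos_less: "a < l \<Longrightarrow> t < n \<Longrightarrow> pos (a * n + t) < l * n"
  using pos_block_bij by (auto simp: bij_betw_def)

lemma pos_surj:
  assumes "r < l * n"
  obtains a t where "a < l" "t < n" "r = pos (a * n + t)"
proof -
  have "r \<in> (\<lambda>(a, t). pos (a * n + t)) ` ({..<l} \<times> {..<n})"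
    using bij_betw_imp_surj_on[OF pos_block_bij] assms by simp
  then show ?thesis using that by auto
qed

lemma card_color_in:
  assumes "S \<subseteq> {..<l * n}" "a < l"
  shows "card {i \<in> S. c i = a} = card {t. t < n \<and> pos (a * n + t) \<in> S}"
proof (rule bij_betw_same_card[symmetric])
  have inj: "inj_on (\<lambda>t. pos (a * n + t)) {..<n}"
    using pos_block_bij assms(2) by (auto simp: bij_betw_def inj_on_def)
  show "bij_betw (\<lambda>t. pos (a * n + t)) {t. t < n \<and> pos (a * n + t) \<in> S} {i \<in> S. c i = a}"
    unfolding bij_betw_def
  proof
    show "(\<lambda>t. pos (a * n + t)) ` {t. t < n \<and> pos (a * n + t) \<in> S} = {i \<in> S. c i = a}"
    proof
      show "{i \<in> S. c i = a} \<subseteq> (\<lambda>t. pos (a * n + t)) ` {t. t < n \<and> pos (a * n + t) \<in> S}"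
      proof
        fix r assume r: "r \<in> {i \<in> S. c i = a}"
        then have "r < l * n" using assms(1) by auto
        then obtain b t where "b < l" "t < n" "r = pos (b * n + t)"
          by (elim pos_surj)
        then show "r \<in> (\<lambda>t. pos (a * n + t)) ` {t. t < n \<and> pos (a * n + t) \<in> S}"
          using r color_pos by auto
      qed
    qed (use assms color_pos in auto)
  qed (rule inj_on_subset[OF inj], auto)
qed

lemma cascaded_norm_blocks:
  assumes "p \<ge> 1" "q \<ge> 1" "A \<in> carrier_mat (l * n) d" "C \<in> carrier_mat (l * n) d"
  shows "cascaded_norm p q (A - C) =
    lp_norm p {..<l} (\<lambda>a. lp_norm p {..<n} (\<lambda>t. row_dist q A (pos (a * n + t)) C (pos (a * n + t))))"
  using assms lp_norm_reindex[OF pos_block_bij]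
  by (simp add: cascaded_norm_diff lp_norm_Times case_prod_unfold)

lemma card_cluster_color:
  assumes "C \<in> carrier_mat (l * n) d" "a < l"
  shows "card {i \<in> cluster C j. c i = a} = card {t. t < n \<and> row C (pos (a * n + t)) = row C j}"
proof -
  have "cluster C j \<subseteq> {..<l * n}" using assms by (auto simp: cluster_def)
  moreover have "t < n \<and> pos (a * n + t) \<in> cluster C j \<longleftrightarrow> t < n \<and> row C (pos (a * n + t)) = row C j" for t
    using assms pos_less[of a t] by (auto simp: cluster_def)
  ultimately show ?thesis using card_color_in[of "cluster C j" a] assms by simp
qed

text \<open>If \<open>v\<close> is a row of \<open>C\<close>, balancedness of its cluster equates
  the numbers of positions in blocks \<open>a\<close> and \<open>b\<close> that carry
  \<open>v\<close>; otherwise both numbers are 0. So the two blocks have equal fibres and a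
  permutation aligns them.\<close>

lemma fair_matching:
  assumes "C \<in> fair_clusterings k l n d c" "a < l" "b < l"
  obtains \<sigma> where "\<sigma> \<in> perfect_matchings n"
    "\<And>t. t < n \<Longrightarrow> row C (pos (a * n + t)) = row C (pos (b * n + \<sigma> t))"
proof -
  have C: "C \<in> carrier_mat (l * n) d"
    using assms by (auto simp: fair_clusterings_def clusterings_def)
  have "card {t. t < n \<and> row C (pos (a * n + t)) = v} = card {t. t < n \<and> row C (pos (b * n + t)) = v}" for v
  proof (cases "\<exists>j<l * n. v = row C j")
    case True
    then obtain j where j: "j < l * n" "v = row C j" by blast
    then have "balanced_set l c (cluster C j)"
      using assms by (auto simp: fair_clusterings_def)
    then have "card {i \<in> cluster C j. c i = a} = card {i \<in> cluster C j. c i = b}"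
      using assms(2,3) unfolding balanced_set_def by blast
    then show ?thesis
      using assms(2,3) by (simp add: card_cluster_color[OF C] j(2))
  next
    case False
    then have "{t. t < n \<and> row C (pos (a * n + t)) = v} = {}" "{t. t < n \<and> row C (pos (b * n + t)) = v} = {}"
      using assms pos_less by auto
    then show ?thesis by (simp only:)
  qed
  then obtain \<sigma> where "bij_betw \<sigma> {..<n} {..<n}"
      "\<And>t. t < n \<Longrightarrow> row C (pos (a * n + t)) = row C (pos (b * n + \<sigma> t))"
    using equal_fibres_imp_bij[of n "\<lambda>t. row C (pos (a * n + t))" "\<lambda>t. row C (pos (b * n + t))"] by blast
  then show ?thesis using that by (simp add: perfect_matchings_def)
qed

text \<open>In each block, \<open>\<pi> j\<close> carries the fibres of \<open>C\<close> bijectively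
  onto those of \<open>F\<close>. So a cluster of \<open>F\<close> has as many points of any color
  as the corresponding fibre of \<open>C\<close>, and no row of \<open>F\<close> is new, which keeps
  the bound \<open>k\<close>.\<close>

lemma transported_clustering_fair:
  assumes C: "C \<in> clusterings k n d"
    and \<pi>: "\<And>j. j < l \<Longrightarrow> \<pi> j \<in> perfect_matchings n"
    and F: "F \<in> carrier_mat (l * n) d"
      "\<And>j t e. j < l \<Longrightarrow> t < n \<Longrightarrow> e < d \<Longrightarrow> F $$ (pos (j * n + \<pi> j t), e) = C $$ (t, e)"
  shows "F \<in> fair_clusterings k l n d c"
proof -
  have C': "C \<in> carrier_mat n d" using C by (simp add: clusterings_def)
  have bij: "bij_betw (\<pi> j) {..<n} {..<n}" if "j < l" for j
    using \<pi>[OF that] by (simp add: perfect_matchings_def)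
  have less: "\<pi> j t < n" if "j < l" "t < n" for j t
    using bij[OF that(1)] that by (auto simp: bij_betw_def)
  have row: "row F (pos (j * n + \<pi> j t)) = row C t" if "j < l" "t < n" for j t
    using that F C' pos_less[OF that(1) less[OF that]] by (intro eq_vecI) auto
  have cnt: "card {t. t < n \<and> row F (pos (j * n + t)) = v} = card {t. t < n \<and> row C t = v}" if "j < l" for j v
  proof (rule bij_betw_same_card[symmetric])
    show "bij_betw (\<pi> j) {t. t < n \<and> row C t = v} {t. t < n \<and> row F (pos (j * n + t)) = v}"
      unfolding bij_betw_def
    proof
      show "inj_on (\<pi> j) {t. t < n \<and> row C t = v}"
        using bij[OF that] by (auto simp: bij_betw_def inj_on_def)
      show "\<pi> j ` {t. t < n \<and> row C t = v} = {t. t < n \<and> row F (pos (j * n + t)) = v}"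
      proof
        show "\<pi> j ` {t. t < n \<and> row C t = v} \<subseteq> {t. t < n \<and> row F (pos (j * n + t)) = v}"
          using row[OF that] less[OF that] by auto
        show "{t. t < n \<and> row F (pos (j * n + t)) = v} \<subseteq> \<pi> j ` {t. t < n \<and> row C t = v}"
        proof
          fix u assume u: "u \<in> {t. t < n \<and> row F (pos (j * n + t)) = v}"
          then have "u \<in> \<pi> j ` {..<n}" using bij[OF that] by (auto simp: bij_betw_def)
          then obtain t where "t < n" "u = \<pi> j t" by auto
          then show "u \<in> \<pi> j ` {t. t < n \<and> row C t = v}" using u row[OF that] by auto
        qed
      qed
    qed
  qed
  have "set (rows F) \<subseteq> set (rows C)"
  proof
    fix v assume "v \<in> set (rows F)"
    then obtain r where r: "r < l * n" "v = row F r" using F(1) by (auto simp: rows_def)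
    then obtain j u where ju: "j < l" "u < n" "r = pos (j * n + u)" by (elim pos_surj)
    have "u \<in> \<pi> j ` {..<n}" using bij[OF ju(1)] ju by (auto simp: bij_betw_def)
    then obtain t where "t < n" "u = \<pi> j t" by auto
    then show "v \<in> set (rows C)" using r ju row C' by (auto simp: rows_def)
  qed
  then have "card (set (rows F)) \<le> k"
    using C card_mono[of "set (rows C)" "set (rows F)"] by (simp add: clusterings_def)
  moreover have "balanced_set l c (cluster F j)" for j
    unfolding balanced_set_def using card_cluster_color[OF F(1)] cnt by simp
  ultimately show ?thesis
    using F(1) by (simp add: fair_clusterings_def clusterings_def)
qed

text \<open>Averaging: replacing every block cost by the least one does not increase the
  \<open>lp_norm\<close> over the colors, and the norm of a constant brings in the power 1/p of
  \<open>l\<close>.\<close>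

lemma ex_cheap_color:
  assumes "p \<ge> 1" "A \<in> carrier_mat (l * n) d" "C \<in> carrier_mat (l * n) d" "q \<ge> 1"
  obtains a where "a < l" "real l powr (1 / p) *
    lp_norm p {..<n} (\<lambda>t. row_dist q A (pos (a * n + t)) C (pos (a * n + t))) \<le> cascaded_norm p q (A - C)"
proof -
  define D where "D = (\<lambda>a. lp_norm p {..<n} (\<lambda>t. row_dist q A (pos (a * n + t)) C (pos (a * n + t))))"
  have nonneg: "D a \<ge> 0" for a by (simp add: D_def)
  define a where "a = arg_min_on D {..<l}"
  have fin: "finite {..<l}" "{..<l} \<noteq> {}" using l_pos by (auto simp: lessThan_empty_iff)
  have "a < l" using arg_min_if_finite(1)[OF fin, of D] by (simp add: a_def)
  have "D a \<le> D b" if "b < l" for b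
    using arg_min_least[OF fin, of b D] that by (simp add: a_def)
  then have "lp_norm p {..<l} (\<lambda>_. D a) \<le> lp_norm p {..<l} D"
    using assms(1) nonneg by (intro lp_norm_mono) auto
  then have "real l powr (1 / p) * D a \<le> cascaded_norm p q (A - C)"
    using assms nonneg by (simp add: lp_norm_const cascaded_norm_blocks D_def)
  then show ?thesis using that \<open>a < l\<close> by (simp add: D_def)
qed

text \<open>A point of class \<open>j\<close> reaches its center through its partner in class
  \<open>i\<close>. Minkowski inside a block gives \<open>(\<alpha> + 1) * D + E j\<close>; a second
  use over the blocks separates the constant part, whose norm yields the power 1/p of
  \<open>l\<close>, from the part that adds up to the cost of \<open>G\<close>.\<close>

lemma transported_clustering_cost:
  assumes p: "p \<ge> 1" and q: "q \<ge> 1" and \<alpha>: "\<alpha> \<ge> 0"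
    and A: "A \<in> carrier_mat (l * n) d" and G: "G \<in> fair_clusterings k l n d c" and i: "i < l"
    and D: "D = lp_norm p {..<n} (\<lambda>t. row_dist q A (pos (i * n + t)) G (pos (i * n + t)))"
    and C: "approx_optimal \<alpha> (\<lambda>C. cascaded_norm p q (color_class A pos n i - C)) (clusterings k n d) C"
    and \<pi>: "\<And>j. j < l \<Longrightarrow> min_cost_matching n p q (color_class A pos n i) (color_class A pos n j) (\<pi> j)"
    and F: "F \<in> carrier_mat (l * n) d"
      "\<And>j t e. j < l \<Longrightarrow> t < n \<Longrightarrow> e < d \<Longrightarrow> F $$ (pos (j * n + \<pi> j t), e) = C $$ (t, e)"
  shows "cascaded_norm p q (A - F) \<le> (\<alpha> + 1) * (real l powr (1 / p) * D) + cascaded_norm p q (A - G)"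
proof -
  let ?X = "color_class A pos n"
  define E where "E = (\<lambda>a. lp_norm p {..<n} (\<lambda>t. row_dist q A (pos (a * n + t)) G (pos (a * n + t))))"
  have DE: "D = E i" by (simp add: D E_def)
  have G': "G \<in> carrier_mat (l * n) d" "card (set (rows G)) \<le> k"
    using G by (auto simp: fair_clusterings_def clusterings_def)
  have C': "C \<in> carrier_mat n d" using C by (auto simp: approx_optimal_def clusterings_def)
  have X: "?X a \<in> carrier_mat n d" for a using A by (rule color_class_carrier)
  have bij: "bij_betw (\<pi> j) {..<n} {..<n}" if "j < l" for j
    using \<pi>[OF that] by (simp add: min_cost_matching_def perfect_matchings_def)
  have less: "\<pi> j t < n" if "j < l" "t < n" for j t
    using bij[OF that(1)] that by (auto simp: bij_betw_def)
  have E_nonneg: "E a \<ge> 0" for a by (simp add: E_def)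
  have EX: "E a = lp_norm p {..<n} (\<lambda>t. row_dist q (?X a) t (color_class G pos n a) t)" for a
    unfolding E_def using A G' by (intro lp_norm_cong) (simp add: row_dist_color_class)

  have match: "lp_norm p {..<n} (\<lambda>t. row_dist q (?X i) t (?X j) (\<pi> j t)) \<le> D + E j" if j: "j < l" for j
  proof -
    obtain \<sigma> where \<sigma>: "\<sigma> \<in> perfect_matchings n"
        "\<And>t. t < n \<Longrightarrow> row G (pos (i * n + t)) = row G (pos (j * n + \<sigma> t))"
      using fair_matching[OF G i j] by metis
    have \<sigma>b: "bij_betw \<sigma> {..<n} {..<n}" using \<sigma> by (simp add: perfect_matchings_def)
    have \<sigma>l: "\<sigma> t < n" if "t < n" for t using \<sigma>b that by (auto simp: bij_betw_def)
    have "lp_norm p {..<n} (\<lambda>t. row_dist q (?X i) t (?X j) (\<pi> j t)) = matching_cost p q (?X i) (?X j) (\<pi> j)"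
      using \<pi>[OF j] X by (subst matching_cost_row_dist[of _ n d]) (auto simp: min_cost_matching_def)
    also have "\<dots> \<le> matching_cost p q (?X i) (?X j) \<sigma>"
      using \<pi>[OF j] \<sigma> by (simp add: min_cost_matching_def)
    also have "\<dots> = lp_norm p {..<n} (\<lambda>t. row_dist q (?X i) t (?X j) (\<sigma> t))"
      using \<sigma> X by (subst matching_cost_row_dist[of _ n d]) auto
    also have "\<dots> \<le> lp_norm p {..<n} (\<lambda>t. row_dist q (?X i) t (color_class G pos n i) t +
        row_dist q (?X j) (\<sigma> t) (color_class G pos n j) (\<sigma> t))"
    proof (rule lp_norm_mono[OF p])
      fix t assume "t \<in> {..<n}"
      then have t: "t < n" by simp
      \<comment> \<open>Partners under \<open>\<sigma>\<close> share their center in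
        \<open>G\<close>, so this center can serve as the intermediate point between them.\<close>
      have "G $$ (pos (i * n + t), e) = G $$ (pos (j * n + \<sigma> t), e)" if "e < d" for e
      proof -
        have "row G (pos (i * n + t)) $ e = row G (pos (j * n + \<sigma> t)) $ e"
          using \<sigma>(2)[OF t] by simp
        then show ?thesis using that G'(1) pos_less[OF i t] pos_less[OF j \<sigma>l[OF t]] by simp
      qed
      then have "row_dist q (color_class G pos n i) t (?X j) (\<sigma> t) =
          row_dist q (color_class G pos n j) (\<sigma> t) (?X j) (\<sigma> t)"
        unfolding row_dist_def using G' t \<sigma>l[OF t] by (auto simp: color_class_def intro!: lp_norm_cong)
      also have "\<dots> = row_dist q (?X j) (\<sigma> t) (color_class G pos n j) (\<sigma> t)"
        using A G' by (intro row_dist_commute) (simp add: color_class_def)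
      finally show "\<bar>row_dist q (?X i) t (?X j) (\<sigma> t)\<bar> \<le> \<bar>row_dist q (?X i) t (color_class G pos n i) t +
          row_dist q (?X j) (\<sigma> t) (color_class G pos n j) (\<sigma> t)\<bar>"
        using row_dist_triangle[OF q, of "?X i" "color_class G pos n i" t "?X j" "\<sigma> t" t] A G'
        by (simp add: color_class_def)
    qed
    also have "\<dots> \<le> E i + lp_norm p {..<n} (\<lambda>t. row_dist q (?X j) (\<sigma> t) (color_class G pos n j) (\<sigma> t))"
      unfolding EX by (rule lp_norm_triangle) (use p in auto)
    also have "lp_norm p {..<n} (\<lambda>t. row_dist q (?X j) (\<sigma> t) (color_class G pos n j) (\<sigma> t)) = E j"
      unfolding EX by (rule lp_norm_reindex[OF \<sigma>b, symmetric])
    finally show ?thesis by (simp add: DE)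
  qed

  \<comment> \<open>The restriction of \<open>G\<close> to color \<open>i\<close> is a feasible
    unconstrained clustering of that class with cost \<open>D\<close>, so the unconstrained optimum
    there is at most \<open>D\<close>.\<close>
  have "color_class G pos n i \<in> clusterings k n d"
  proof -
    have "set (rows (color_class G pos n i)) \<subseteq> set (rows G)"
    proof
      fix v assume "v \<in> set (rows (color_class G pos n i))"
      then obtain t where t: "t < n" "v = row (color_class G pos n i) t"
        by (auto simp: rows_def color_class_def)
      then have "v = row G (pos (i * n + t))"
        using G' pos_less[OF i] by (intro eq_vecI) (auto simp: color_class_def)
      then show "v \<in> set (rows G)" using pos_less[OF i t(1)] G' by (auto simp: rows_def)
    qed
    then have "card (set (rows (color_class G pos n i))) \<le> card (set (rows G))"
      by (intro card_mono) auto
    then show ?thesis using G' color_class_carrier[OF G'(1)] by (simp add: clusterings_def)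
  qed
  then have "(INF C\<in>clusterings k n d. cascaded_norm p q (?X i - C)) \<le> cascaded_norm p q (?X i - color_class G pos n i)"
    by (intro cINF_lower bdd_belowI[of _ 0]) (auto simp: cascaded_norm_def)
  also have "\<dots> = D"
    using p q X color_class_carrier[OF G'(1)] unfolding DE EX by (subst cascaded_norm_diff) auto
  finally have CD: "lp_norm p {..<n} (\<lambda>t. row_dist q (?X i) t C t) \<le> \<alpha> * D"
    using C mult_left_mono[OF _ \<alpha>] unfolding approx_optimal_def cascaded_norm_diff[OF p q X C']
    by fastforce

  have block: "lp_norm p {..<n} (\<lambda>t. row_dist q A (pos (j * n + t)) F (pos (j * n + t))) \<le> (\<alpha> + 1) * D + E j"
    if j: "j < l" for j
  proof -
    \<comment> \<open>\<open>F\<close> is prescribed at matched positions; reindexing by the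
      bijection \<open>\<pi> j\<close> brings all of block \<open>j\<close> into this form.\<close>
    have "lp_norm p {..<n} (\<lambda>t. row_dist q A (pos (j * n + t)) F (pos (j * n + t))) =
        lp_norm p {..<n} (\<lambda>t. row_dist q A (pos (j * n + \<pi> j t)) F (pos (j * n + \<pi> j t)))"
      by (rule lp_norm_reindex[OF bij[OF j]])
    also have "\<dots> = lp_norm p {..<n} (\<lambda>t. row_dist q (?X j) (\<pi> j t) C t)"
      using F(2)[OF j] less[OF j] A by (auto simp: row_dist_def color_class_def intro!: lp_norm_cong)
    also have "\<dots> \<le> lp_norm p {..<n} (\<lambda>t. row_dist q (?X i) t C t + row_dist q (?X i) t (?X j) (\<pi> j t))"
    proof (rule lp_norm_mono[OF p])
      fix t
      show "\<bar>row_dist q (?X j) (\<pi> j t) C t\<bar> \<le> \<bar>row_dist q (?X i) t C t + row_dist q (?X i) t (?X j) (\<pi> j t)\<bar>"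
        using row_dist_triangle[OF q, of "?X j" "?X i" "\<pi> j t" C t t]
          row_dist_commute[of "?X j" "?X i" q "\<pi> j t" t] by (simp add: color_class_def)
    qed
    also have "\<dots> \<le> lp_norm p {..<n} (\<lambda>t. row_dist q (?X i) t C t)
        + lp_norm p {..<n} (\<lambda>t. row_dist q (?X i) t (?X j) (\<pi> j t))"
      by (rule lp_norm_triangle) (use p in auto)
    also have "\<dots> \<le> \<alpha> * D + (D + E j)"
      by (intro add_mono CD match j)
    finally show ?thesis by (simp add: algebra_simps)
  qed
  have "cascaded_norm p q (A - F) \<le> lp_norm p {..<l} (\<lambda>j. (\<alpha> + 1) * D + E j)"
    unfolding cascaded_norm_blocks[OF p q A F(1)]
  proof (rule lp_norm_mono[OF p])
    fix j assume "j \<in> {..<l}"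
    then show "\<bar>lp_norm p {..<n} (\<lambda>t. row_dist q A (pos (j * n + t)) F (pos (j * n + t)))\<bar> \<le> \<bar>(\<alpha> + 1) * D + E j\<bar>"
      using block[of j] lp_norm_nonneg[of p "{..<n}" "\<lambda>t. row_dist q A (pos (j * n + t)) F (pos (j * n + t))"]
      by simp
  qed
  also have "\<dots> \<le> lp_norm p {..<l} (\<lambda>j. (\<alpha> + 1) * D) + lp_norm p {..<l} E"
    by (rule lp_norm_triangle) (use p in auto)
  also have "lp_norm p {..<l} (\<lambda>j. (\<alpha> + 1) * D) = (\<alpha> + 1) * (real l powr (1 / p) * D)"
    using p \<alpha> E_nonneg[of i] by (simp add: lp_norm_const abs_mult DE)
  also have "lp_norm p {..<l} E = cascaded_norm p q (A - G)"
    unfolding cascaded_norm_blocks[OF p q A G'(1)] E_def ..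
  finally show ?thesis .
qed

text \<open>The best candidate is compared with one whose pivot may depend on \<open>G\<close>.
  Division by \<open>\<alpha> + 2\<close> turns the resulting bound into a lower bound for the costs
  of all fair clusterings, hence for their infimum; \<open>F b\<close> itself shows that there are
  any.\<close>

lemma best_transported_clustering:
  assumes p: "p \<ge> 1" and q: "q \<ge> 1" and \<alpha>: "\<alpha> \<ge> 0"
    and A: "A \<in> carrier_mat (l * n) d"
    and C: "\<And>i. i < l \<Longrightarrow>
      approx_optimal \<alpha> (\<lambda>C. cascaded_norm p q (color_class A pos n i - C)) (clusterings k n d) (C i)"
    and \<pi>: "\<And>i j. i < l \<Longrightarrow> j < l \<Longrightarrow>
      min_cost_matching n p q (color_class A pos n i) (color_class A pos n j) (\<pi> i j)"
    and F: "\<And>i. i < l \<Longrightarrow> F i \<in> carrier_mat (l * n) d"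
      "\<And>i j t e. i < l \<Longrightarrow> j < l \<Longrightarrow> t < n \<Longrightarrow> e < d \<Longrightarrow>
        F i $$ (pos (j * n + \<pi> i j t), e) = C i $$ (t, e)"
    and b: "b < l" "\<And>i. i < l \<Longrightarrow> cascaded_norm p q (A - F b) \<le> cascaded_norm p q (A - F i)"
  shows "approx_optimal (\<alpha> + 2) (\<lambda>C. cascaded_norm p q (A - C)) (fair_clusterings k l n d c) (F b)"
proof -
  have fair: "F b \<in> fair_clusterings k l n d c"
    using C[OF b(1)] \<pi>[OF b(1)] F b(1)
    by (intro transported_clustering_fair[of "C b" k d "\<pi> b"]) (auto simp: approx_optimal_def min_cost_matching_def)
  have "cascaded_norm p q (A - F b) / (\<alpha> + 2) \<le> cascaded_norm p q (A - G)"
    if G: "G \<in> fair_clusterings k l n d c" for G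
  proof -
    have G': "G \<in> carrier_mat (l * n) d"
      using G by (auto simp: fair_clusterings_def clusterings_def)
    obtain i where i: "i < l" and cheap: "real l powr (1 / p) *
        lp_norm p {..<n} (\<lambda>t. row_dist q A (pos (i * n + t)) G (pos (i * n + t))) \<le> cascaded_norm p q (A - G)"
      using ex_cheap_color[OF p A G' q] by metis
    have "cascaded_norm p q (A - F b) \<le> cascaded_norm p q (A - F i)" using b(2) i by simp
    also have "\<dots> \<le> (\<alpha> + 1) * (real l powr (1 / p) *
        lp_norm p {..<n} (\<lambda>t. row_dist q A (pos (i * n + t)) G (pos (i * n + t)))) + cascaded_norm p q (A - G)"
      by (rule transported_clustering_cost[OF p q \<alpha> A G i refl C \<pi> F]) (use i in auto)
    also have "\<dots> \<le> (\<alpha> + 1) * cascaded_norm p q (A - G) + cascaded_norm p q (A - G)"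
      using cheap \<alpha> by (intro add_right_mono mult_left_mono) auto
    finally show ?thesis using \<alpha> by (simp add: field_simps)
  qed
  then have "cascaded_norm p q (A - F b) / (\<alpha> + 2) \<le> (INF G\<in>fair_clusterings k l n d c. cascaded_norm p q (A - G))"
    using fair by (intro cINF_greatest) auto
  then show ?thesis using fair \<alpha> by (simp add: approx_optimal_def field_simps)
qed

end

section \<open>Execution within a time bound\<close>

text \<open>Total correctness with a time bound. The bound is real because it is assembled from the
  real-valued bounds of the subroutines.\<close>

definition runs :: "com \<Rightarrow> mem \<Rightarrow> real \<Rightarrow> (mem \<Rightarrow> bool) \<Rightarrow> bool" where
  "runs P s B Q \<longleftrightarrow> (\<exists>t s'. exec P s t s' \<and> real t \<le> B \<and> Q s')"

lemma runs_mono: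
  "runs P s B Q \<Longrightarrow> B \<le> B' \<Longrightarrow> (\<And>s'. Q s' \<Longrightarrow> Q' s') \<Longrightarrow> runs P s B' Q'"
  unfolding runs_def by (meson order_trans)

lemma runs_Skip: "1 \<le> B \<Longrightarrow> Q s \<Longrightarrow> runs Skip s B Q"
  unfolding runs_def using exec.Skip by fastforce

lemma runs_NSet:
  "real (1 + ncost e + ncost f) \<le> B \<Longrightarrow> Q (set_nat x (neval e s) (neval f s) s) \<Longrightarrow> runs (NSet x e f) s B Q"
  unfolding runs_def using exec.NSet by blast

lemma runs_RSet:
  "real (1 + ncost e + rcost f) \<le> B \<Longrightarrow> Q (set_real x (neval e s) (reval f s) s) \<Longrightarrow> runs (RSet x e f) s B Q"
  unfolding runs_def using exec.RSet by blast

text \<open>The postcondition of the first program is that the second one runs as desired, so no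
  assertion between the two has to be named.\<close>

lemma runs_Seq:
  assumes "runs P s B1 (\<lambda>s'. runs R s' B2 Q)" "B1 + B2 \<le> B"
  shows "runs (Seq P R) s B Q"
proof -
  obtain t s' where 1: "exec P s t s'" "real t \<le> B1" "runs R s' B2 Q"
    using assms(1) unfolding runs_def by blast
  then obtain t' s'' where 2: "exec R s' t' s''" "real t' \<le> B2" "Q s''"
    unfolding runs_def by blast
  have "real (t + t') \<le> B" using 1 2 assms(2) by simp
  then show ?thesis unfolding runs_def using exec.Seq[OF 1(1) 2(1)] 2(3) by blast
qed

lemma runs_If:
  assumes "beval b s \<Longrightarrow> runs P s B1 Q" "\<not> beval b s \<Longrightarrow> runs R s B1 Q" "1 + real (bcost b) + B1 \<le> B"
  shows "runs (If b P R) s B Q"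
proof -
  obtain t s' where "exec (If b P R) s (1 + bcost b + t) s'" "real t \<le> B1" "Q s'"
    using assms(1,2) exec.IfTrue exec.IfFalse unfolding runs_def by metis
  moreover from this have "real (1 + bcost b + t) \<le> B" using assms(3) by simp
  ultimately show ?thesis unfolding runs_def by blast
qed

lemma runs_Call:
  assumes "exec P (load (map (nats s x) [0..<neval e s]) (map (reals s y) [0..<neval f s])) t r"
    and "real (1 + ncost e + ncost f + ncost g + ncost h
      + neval e s + neval f s + t + neval g s + neval h s) \<le> B"
    and "Q (copy_back u (neval g s) v (neval h s) r s)"
  shows "runs (Call P x e y f u g v h) s B Q"
  unfolding runs_def using exec.Call[OF assms(1)] assms(2,3) by blast

section \<open>Counting loops\<close>

definition For :: "nat \<Rightarrow> nexp \<Rightarrow> com \<Rightarrow> com" where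
  "For v m P = Seq (NSet v (NConst 0) (NConst 0))
     (While (NLess (NGet v (NConst 0)) m)
       (Seq P (NSet v (NConst 0) (NAdd (NGet v (NConst 0)) (NConst 1)))))"

text \<open>Induction on the number of remaining rounds. The invariant is required after the
  increment, at the loop head, and must fix the value of \<open>m\<close>, which is evaluated at
  every test. The overhead 10 per round consists of 4 for the test and 6 for the increment, apart
  from \<open>ncost m\<close>; the last, failing test accounts for the final \<open>ncost m\<close>
  and 4.\<close>

lemma runs_While_count:
  assumes step: "\<And>i s. i < N \<Longrightarrow> I i s \<Longrightarrow> nats s v 0 = i \<Longrightarrow>
      runs P s b (\<lambda>s'. nats s' v 0 = i \<and> I (Suc i) (set_nat v 0 (Suc i) s'))"
    and bound: "\<And>i s. I i s \<Longrightarrow> neval m s = N"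
    and i: "i \<le> N" "I i s" "nats s v 0 = i"
  shows "runs (While (NLess (NGet v (NConst 0)) m)
      (Seq P (NSet v (NConst 0) (NAdd (NGet v (NConst 0)) (NConst 1))))) s
    (real (N - i) * (b + real (ncost m) + 10) + real (ncost m) + 4) (I N)"
  using i
proof (induction "N - i" arbitrary: i s)
  case 0
  then have "\<not> beval (NLess (NGet v (NConst 0)) m) s" "i = N" using bound by auto
  then show ?case
    unfolding runs_def using exec.WhileFalse 0 by fastforce
next
  case (Suc x)
  let ?b = "NLess (NGet v (NConst 0)) m"
  let ?P = "Seq P (NSet v (NConst 0) (NAdd (NGet v (NConst 0)) (NConst 1)))"
  have iN: "i < N" using Suc.hyps(2) by simp
  obtain t s' where 1: "exec P s t s'" "real t \<le> b" "nats s' v 0 = i" "I (Suc i) (set_nat v 0 (Suc i) s')"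
    using step[OF iN Suc.prems(2,3)] unfolding runs_def by blast
  have 2: "exec ?P s (t + 6) (set_nat v 0 (Suc i) s')"
    using exec.Seq[OF 1(1) exec.NSet[of v "NConst 0" "NAdd (NGet v (NConst 0)) (NConst 1)" s']] 1(3)
    by (simp add: eval_nat_numeral)
  have "runs (While ?b ?P) (set_nat v 0 (Suc i) s')
      (real (N - Suc i) * (b + real (ncost m) + 10) + real (ncost m) + 4) (I N)"
    using Suc.hyps 1 iN by (intro Suc.hyps(1)) (auto simp: set_nat_def)
  then obtain t' s'' where 3: "exec (While ?b ?P) (set_nat v 0 (Suc i) s') t' s''"
      "real t' \<le> real (N - Suc i) * (b + real (ncost m) + 10) + real (ncost m) + 4" "I N s''"
    unfolding runs_def by blast
  have "beval ?b s" using bound[OF Suc.prems(2)] Suc.prems(3) iN by simp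
  from exec.WhileTrue[OF this 2 3(1)]
  have "exec (While ?b ?P) s (1 + bcost ?b + (t + 6) + t') s''" .
  moreover have "real (1 + bcost ?b + (t + 6) + t') \<le>
      real (N - i) * (b + real (ncost m) + 10) + real (ncost m) + 4"
  proof -
    have "real (N - i) = 1 + real (N - Suc i)" using iN by simp
    then have "real (N - i) * (b + real (ncost m) + 10) =
        (b + real (ncost m) + 10) + real (N - Suc i) * (b + real (ncost m) + 10)"
      by (simp only: distrib_right mult_1_left)
    moreover have "real (1 + bcost ?b + (t + 6) + t') = real (ncost m) + 10 + real t + real t'" by simp
    ultimately show ?thesis using 1(2) 3(2) by linarith
  qed
  ultimately show ?case unfolding runs_def using 3(3) by blast
qed

lemma runs_For:
  assumes "I 0 (set_nat v 0 0 s)"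
    and "\<And>i s. i < N \<Longrightarrow> I i s \<Longrightarrow> nats s v 0 = i \<Longrightarrow>
      runs P s b (\<lambda>s'. nats s' v 0 = i \<and> I (Suc i) (set_nat v 0 (Suc i) s'))"
    and "\<And>i s. I i s \<Longrightarrow> neval m s = N"
    and "real N * (b + real (ncost m) + 10) + real (ncost m) + 7 \<le> B"
    and "\<And>s. I N s \<Longrightarrow> Q s"
  shows "runs (For v m P) s B Q"
  unfolding For_def
proof (rule runs_Seq[OF runs_NSet])
  show "runs (While (NLess (NGet v (NConst 0)) m)
      (Seq P (NSet v (NConst 0) (NAdd (NGet v (NConst 0)) (NConst 1)))))
      (set_nat v (neval (NConst 0) s) (neval (NConst 0) s) s)
      (real N * (b + real (ncost m) + 10) + real (ncost m) + 4) Q"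
    using runs_While_count[of N I v P b m 0 "set_nat v 0 0 s"] assms
    by (auto simp: set_nat_def intro: runs_mono)
  show "real (1 + ncost (NConst 0) + ncost (NConst 0)) \<le> 3" by simp
qed (use assms(4) in simp)

section \<open>Frame conditions\<close>

primrec nreads :: "nexp \<Rightarrow> nat set" where
  "nreads (NConst m) = {}"
| "nreads (NGet x e) = insert x (nreads e)"
| "nreads (NAdd e f) = nreads e \<union> nreads f"
| "nreads (NSub e f) = nreads e \<union> nreads f"
| "nreads (NMul e f) = nreads e \<union> nreads f"

lemma neval_cong: "(\<And>x. x \<in> nreads e \<Longrightarrow> nats s x = nats s' x) \<Longrightarrow> neval e s = neval e s'"
  by (induction e) auto

text \<open>Frames whole arrays. Which cells of a changed array survive is stated separately
  wherever it matters.\<close>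

definition keeps :: "nat set \<Rightarrow> nat set \<Rightarrow> mem \<Rightarrow> mem \<Rightarrow> bool" where
  "keeps X Y s s' \<longleftrightarrow> (\<forall>x. x \<notin> X \<longrightarrow> nats s' x = nats s x) \<and> (\<forall>y. y \<notin> Y \<longrightarrow> reals s' y = reals s y)"

lemma keeps_refl [simp]: "keeps X Y s s"
  by (simp add: keeps_def)

lemma keeps_trans: "keeps X Y s s' \<Longrightarrow> keeps X Y s' s'' \<Longrightarrow> keeps X Y s s''"
  by (simp add: keeps_def)

lemma keeps_mono: "keeps X Y s s' \<Longrightarrow> X \<subseteq> X' \<Longrightarrow> Y \<subseteq> Y' \<Longrightarrow> keeps X' Y' s s'"
  unfolding keeps_def by blast

lemma keeps_nats: "keeps X Y s s' \<Longrightarrow> x \<notin> X \<Longrightarrow> nats s' x = nats s x"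
  by (simp add: keeps_def)

lemma keeps_reals: "keeps X Y s s' \<Longrightarrow> y \<notin> Y \<Longrightarrow> reals s' y = reals s y"
  by (simp add: keeps_def)

lemma nats_set_nat: "nats (set_nat x i a s) = (nats s)(x := (nats s x)(i := a))"
  and reals_set_nat [simp]: "reals (set_nat x i a s) = reals s"
  and nats_set_real [simp]: "nats (set_real x i b s) = nats s"
  and reals_set_real: "reals (set_real x i b s) = (reals s)(x := (reals s x)(i := b))"
  by (simp_all add: set_nat_def set_real_def)

lemma keeps_set_nat: "keeps X Y s s' \<Longrightarrow> x \<in> X \<Longrightarrow> keeps X Y s (set_nat x i a s')"
  and keeps_set_real: "keeps X Y s s' \<Longrightarrow> y \<in> Y \<Longrightarrow> keeps X Y s (set_real y i b s')"
  by (auto simp: keeps_def nats_set_nat reals_set_real)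

section \<open>Copying cells and rows\<close>

definition copy_range :: "nat \<Rightarrow> nat \<Rightarrow> nexp \<Rightarrow> nat \<Rightarrow> nexp \<Rightarrow> nexp \<Rightarrow> com" where
  "copy_range v y e x f m =
     For v m (RSet y (NAdd e (NGet v (NConst 0))) (RGet x (NAdd f (NGet v (NConst 0)))))"

text \<open>Offsets and length are evaluated anew in every round, so the counter may not occur in
  them. \<open>Q\<close> has the form of a continuation: it has to follow from the listed facts
  about the copy.\<close>

lemma runs_copy_range:
  assumes "x \<noteq> y" "v \<notin> nreads e \<union> nreads f \<union> nreads m"
    and N: "neval m s = N"
    and B: "real (N + 1) * (20 + real (ncost e) + real (ncost f) + real (ncost m)) \<le> B"
    and Q: "\<And>s'. keeps {v} {y} s s' \<Longrightarrow>
      (\<And>i. i < N \<Longrightarrow> reals s' y (neval e s + i) = reals s x (neval f s + i)) \<Longrightarrow>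
      (\<And>i. i < neval e s \<or> neval e s + N \<le> i \<Longrightarrow> reals s' y i = reals s y i) \<Longrightarrow> Q s'"
  shows "runs (copy_range v y e x f m) s B Q"
  unfolding copy_range_def
proof (rule runs_For[where N = N and b = "real (8 + ncost e + ncost f)"
      and I = "\<lambda>j s'. keeps {v} {y} s s' \<and>
        (\<forall>i<j. reals s' y (neval e s + i) = reals s x (neval f s + i)) \<and>
        (\<forall>i. i < neval e s \<or> neval e s + j \<le> i \<longrightarrow> reals s' y i = reals s y i)"], goal_cases)
  case 1
  then show ?case by (simp add: keeps_set_nat)
next
  case (2 j s')
  then have K: "keeps {v} {y} s s'" by blast
  have "neval e s' = neval e s" "neval f s' = neval f s"
    using assms(2) by (auto intro!: neval_cong keeps_nats[OF K])
  moreover have "reals s' x = reals s x" using assms(1) by (auto intro: keeps_reals[OF K])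
  ultimately show ?case
    using 2 by (intro runs_RSet) (auto simp: keeps_set_nat keeps_set_real reals_set_real less_Suc_eq)
next
  case (3 j s')
  then have "neval m s' = neval m s"
    using assms(2) by (intro neval_cong) (auto intro!: keeps_nats[of "{v}" "{y}"])
  then show ?case using N by simp
next
  case 4
  show ?case by (rule order_trans[OF _ B]) (simp add: algebra_simps)
next
  case (5 s')
  then show ?case by (intro Q) auto
qed

definition copy_rows :: "nat \<Rightarrow> nat \<Rightarrow> nexp \<Rightarrow> nexp \<Rightarrow> nat \<Rightarrow> nexp \<Rightarrow> nat \<Rightarrow> nat \<Rightarrow> nexp \<Rightarrow> com" where
  "copy_rows w v R D y f x b g = For w R (copy_range v y (NMul f D) x (NAdd (NConst b) (NMul g D)) D)"

text \<open>One routine sorts the rows, hands centers to matched rows and undoes the sorting.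
  \<open>F\<close> and \<open>G\<close> are the values of the target and source index in round
  \<open>i\<close>; injectivity of \<open>F\<close> makes the targets disjoint, so no row overwrites
  an earlier one.\<close>

lemma runs_copy_rows:
  fixes f g :: nexp and F G :: "nat \<Rightarrow> nat"
  assumes "x \<noteq> y" "v \<noteq> w" "v \<notin> nreads f \<union> nreads g \<union> nreads R \<union> nreads D" "w \<notin> nreads R \<union> nreads D"
    and "neval R s = N" and D: "neval D s = d" "d \<ge> 1"
    and F: "\<And>s' i. keeps {v, w} {y} s s' \<Longrightarrow> nats s' w 0 = i \<Longrightarrow> i < N \<Longrightarrow> neval f s' = F i"
    and G: "\<And>s' i. keeps {v, w} {y} s s' \<Longrightarrow> nats s' w 0 = i \<Longrightarrow> i < N \<Longrightarrow> neval g s' = G i"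
    and inj: "inj_on F {..<N}"
    and B: "real (N * d + 1) * (100 + 2 * real (ncost f) + 2 * real (ncost g) + 10 * real (ncost D) + real (ncost R)) \<le> B"
    and Q: "\<And>s'. keeps {v, w} {y} s s' \<Longrightarrow>
      (\<And>r e. r < N \<Longrightarrow> e < d \<Longrightarrow> reals s' y (F r * d + e) = reals s x (b + G r * d + e)) \<Longrightarrow>
      (\<And>i. (\<And>r e. r < N \<Longrightarrow> e < d \<Longrightarrow> i \<noteq> F r * d + e) \<Longrightarrow> reals s' y i = reals s y i) \<Longrightarrow> Q s'"
  shows "runs (copy_rows w v R D y f x b g) s B Q"
  unfolding copy_rows_def
proof (rule runs_For[where N = N
      and b = "real (d + 1) * (24 + real (ncost f) + real (ncost g) + 3 * real (ncost D))"
      and I = "\<lambda>j s'. keeps {v, w} {y} s s' \<and>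
        (\<forall>r<j. \<forall>e<d. reals s' y (F r * d + e) = reals s x (b + G r * d + e)) \<and>
        (\<forall>i. (\<forall>r<j. \<forall>e<d. i \<noteq> F r * d + e) \<longrightarrow> reals s' y i = reals s y i)"], goal_cases)
  case 1
  then show ?case by (simp add: keeps_set_nat)
next
  case (2 j s')
  then have K: "keeps {v, w} {y} s s'" and copied: "\<And>r e. r < j \<Longrightarrow> e < d \<Longrightarrow> reals s' y (F r * d + e) = reals s x (b + G r * d + e)"
    and same: "\<And>i. (\<And>r e. r < j \<Longrightarrow> e < d \<Longrightarrow> i \<noteq> F r * d + e) \<Longrightarrow> reals s' y i = reals s y i" by blast+
  have eD: "neval D s' = d"
    using assms(3,4) D by (auto intro!: neval_cong keeps_nats[OF K])
  have ef: "neval f s' = F j" "neval g s' = G j" using F G K 2 by auto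
  have xs: "reals s' x = reals s x" using assms(1) by (auto intro: keeps_reals[OF K])
  \<comment> \<open>Division by \<open>d\<close> turns a collision of cells into one of row numbers,
    which injectivity of \<open>F\<close> excludes.\<close>
  have other: "F j * d + e \<noteq> F r * d + e'" if "r < j" "e < d" "e' < d" for r e e'
  proof
    assume eq: "F j * d + e = F r * d + e'"
    have "F j = F r" using arg_cong[OF eq, of "\<lambda>z. z div d"] that D(2) by simp
    from inj_onD[OF inj this] have "j = r" using that(1) 2(1) by simp
    then show False using that(1) by simp
  qed
  show ?case
  proof (rule runs_copy_range[where N = d], goal_cases)
    case 4
    then show ?case by (simp add: algebra_simps)
  next
    case (5 s'')
    have K'': "keeps {v, w} {y} s s''"
      using keeps_trans[OF K] keeps_mono[OF 5(1)] by auto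
    have row: "reals s'' y (F j * d + e) = reals s x (b + G j * d + e)" if "e < d" for e
      using 5(2)[OF that] by (simp add: ef eD xs)
    have old: "reals s'' y i = reals s' y i" if "\<And>e. e < d \<Longrightarrow> i \<noteq> F j * d + e" for i
      using that[of "i - F j * d"] by (intro 5(3)) (simp add: ef eD, linarith)
    have "nats s'' w 0 = j" using 2(3) 5(1) assms(2) by (simp add: keeps_nats)
    moreover have "reals s'' y (F r * d + e) = reals s x (b + G r * d + e)" if "r < Suc j" "e < d" for r e
    proof (cases "r = j")
      case False
      then have "r < j" using that by simp
      then show ?thesis using copied that other by (subst old) (metis, simp)
    qed (use row that in simp)
    moreover have "reals s'' y i = reals s y i" if "\<forall>r<Suc j. \<forall>e<d. i \<noteq> F r * d + e" for i
      using old[of i] same[of i] that by simp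
    ultimately show ?case using K'' by (simp add: keeps_set_nat)
  qed (use assms eD in auto)
next
  case (3 j s')
  then have "neval R s' = neval R s"
    using assms(3,4) by (intro neval_cong) (auto intro!: keeps_nats[of "{v, w}" "{y}"])
  then show ?case using assms(5) by simp
next
  case 4
  let ?c = "24 + real (ncost f) + real (ncost g) + 3 * real (ncost D)"
  \<comment> \<open>Rows are nonempty, so the overhead per row can be charged to its
    entries.\<close>
  have "real N \<le> real (N * d)" using D(2) by (cases d) auto
  then have "real N * (real (d + 1) * ?c + real (ncost R) + 10) + real (ncost R) + 7 \<le>
      real (N * d) * ?c + real (N * d) * ?c + real (N * d) * (real (ncost R) + 10) + real (ncost R) + 7"
  proof -
    have "real N * (real (d + 1) * ?c + real (ncost R) + 10) =
        real (N * d) * ?c + real N * ?c + real N * (real (ncost R) + 10)" by (simp add: algebra_simps)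
    then show ?thesis
      using mult_right_mono[OF \<open>real N \<le> real (N * d)\<close>, of ?c]
        mult_right_mono[OF \<open>real N \<le> real (N * d)\<close>, of "real (ncost R) + 10"] by simp
  qed
  also have "\<dots> \<le> real (N * d + 1) * (100 + 2 * real (ncost f) + 2 * real (ncost g) + 10 * real (ncost D) + real (ncost R))"
    by (simp add: algebra_simps)
  finally show ?case using B by simp
next
  case (5 s')
  then show ?case by (intro Q) auto
qed

section \<open>The program\<close>

lemma concat_map_upt:
  "concat (map (\<lambda>i. map (f i) [0..<m]) [0..<n]) = map (\<lambda>x. f (x div m) (x mod m)) [0..<n * m]"
proof (induction n)
  case (Suc n)
  have "[0..<Suc n * m] = [0..<n * m] @ map (\<lambda>x. n * m + x) [0..<m]"
    using upt_add_eq_append[of 0 "n * m" m] map_add_upt[of "n * m" m] by (simp add: add.commute)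
  moreover have "map (f n) [0..<m] = map (\<lambda>x. f ((n * m + x) div m) ((n * m + x) mod m)) [0..<m]"
    by simp
  ultimately show ?case using Suc.IH by (simp add: comp_def)
qed simp

lemma encode_mat_upt:
  assumes "A \<in> carrier_mat n d"
  shows "encode_mat A = map (\<lambda>x. A $$ (x div d, x mod d)) [0..<n * d]"
  using assms concat_map_upt[of "\<lambda>i j. A $$ (i, j)" d n]
  by (simp add: encode_mat_def mat_to_list_def)

lemma length_encode_mat: "A \<in> carrier_mat n d \<Longrightarrow> length (encode_mat A) = n * d"
  by (simp add: encode_mat_upt)

lemma nth_encode_mat:
  "A \<in> carrier_mat n d \<Longrightarrow> x < n * d \<Longrightarrow> encode_mat A ! x = A $$ (x div d, x mod d)"
  by (simp add: encode_mat_upt)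

lemma nth_encode_color_class:
  assumes "A \<in> carrier_mat N d" "x < n * d"
  shows "encode_mat (color_class A pos n a) ! x = A $$ (pos (a * n + x div d), x mod d)"
proof -
  have "d > 0" using assms(2) by (cases d) auto
  then show ?thesis
    using assms nth_encode_mat[OF color_class_carrier[OF assms(1)] assms(2), of pos a]
    by (simp add: color_class_def less_mult_imp_div_less)
qed

text \<open>Arrays of naturals: \<open>2\<close> input of both subroutines, \<open>3\<close> number of rows seen per color, \<open>4\<close> rows
  ordered by color, \<open>5\<close> current matching, \<open>6\<close> to \<open>9\<close> loop counters.  Arrays of reals: \<open>2\<close> input of
  both subroutines, \<open>3\<close> rows of \<open>A\<close> ordered by color, \<open>4\<close> centers of the current color class,
  \<open>5\<close> current candidate in the order of \<open>3\<close>, \<open>6\<close> its cost, \<open>7\<close> cost of a row, \<open>8\<close> least cost so far.  The outputs that a call does not use go to arrays \<open>10\<close> and \<open>9\<close>.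
  Costs are kept as \<open>p\<close>-th powers.\<close>

abbreviation "scalar x \<equiv> NGet x (NConst 0)"
abbreviation "l_exp \<equiv> NGet 0 (NConst 0)"
abbreviation "n_exp \<equiv> NGet 0 (NConst 1)"
abbreviation "d_exp \<equiv> NGet 0 (NConst 2)"
abbreviation "block_exp \<equiv> NMul n_exp d_exp"
abbreviation "color_exp \<equiv> NGet 0 (NAdd (NConst 4) (scalar 8))"
abbreviation "p_exp \<equiv> RGet 0 (NConst 0)"
abbreviation "q_exp \<equiv> RGet 0 (NConst 1)"

text \<open>Counting sort in a single pass: every color has exactly \<open>n\<close> rows, so block
  \<open>a\<close> starts at \<open>a * n\<close> without counting beforehand. The counter of a
  color is read as its next free place before it is increased.\<close>

definition sort_colors :: com where
  "sort_colors = For 8 (NMul l_exp n_exp)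
     (Seq (NSet 4 (NAdd (NMul color_exp n_exp) (NGet 3 color_exp)) (scalar 8))
          (NSet 3 color_exp (NAdd (NGet 3 color_exp) (NConst 1))))"

definition gather_rows :: com where
  "gather_rows = copy_rows 8 9 (NMul l_exp n_exp) d_exp 3 (scalar 8) 0 2 (NGet 4 (scalar 8))"

text \<open>Both subroutines read from array 2: \<open>U\<close> takes \<open>n, d, k\<close> and
  one color class, \<open>M\<close> takes \<open>n, d\<close> and two classes. So one header serves
  all calls, and later only the real cells after \<open>p, q\<close> are rewritten.\<close>

definition write_header :: com where
  "write_header =
     Seq (NSet 2 (NConst 0) n_exp) (Seq (NSet 2 (NConst 1) d_exp) (Seq (NSet 2 (NConst 2) (NGet 0 (NConst 3)))
       (Seq (RSet 2 (NConst 0) p_exp) (RSet 2 (NConst 1) q_exp))))"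

definition match_color :: "com \<Rightarrow> com" where
  "match_color M =
     Seq (copy_range 9 2 (NAdd (NConst 2) block_exp) 3 (NMul (scalar 7) block_exp) block_exp)
      (Seq (Call M 2 (NConst 2) 2 (NAdd (NConst 2) (NMul (NConst 2) block_exp)) 5 n_exp 9 (NConst 0))
           (copy_rows 8 9 n_exp d_exp 5 (NAdd (NMul (scalar 7) n_exp) (NGet 5 (scalar 8))) 4 0 (scalar 8)))"

definition make_candidate :: "com \<Rightarrow> com \<Rightarrow> com" where
  "make_candidate U M =
     Seq (copy_range 9 2 (NConst 2) 3 (NMul (scalar 6) block_exp) block_exp)
      (Seq (Call U 2 (NConst 3) 2 (NAdd (NConst 2) block_exp) 10 (NConst 0) 4 block_exp)
           (For 7 l_exp (match_color M)))"

definition evaluate_candidate :: com where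
  "evaluate_candidate =
     Seq (RSet 6 (NConst 0) (RNat (NConst 0)))
      (For 8 (NMul l_exp n_exp)
        (Seq (RSet 7 (NConst 0) (RNat (NConst 0)))
         (Seq (For 9 d_exp (RSet 7 (NConst 0) (RAdd (RGet 7 (NConst 0))
                (RPow (RAbs (RSub (RGet 3 (NAdd (NMul (scalar 8) d_exp) (scalar 9)))
                                  (RGet 5 (NAdd (NMul (scalar 8) d_exp) (scalar 9))))) q_exp))))
              (RSet 6 (NConst 0) (RAdd (RGet 6 (NConst 0)) (RPow (RGet 7 (NConst 0)) (RDiv p_exp q_exp)))))))"

text \<open>The condition is a disjunction expressed by negation and conjunction: first round, or
  cheaper than the best so far. In the first round array 8 holds no cost yet, so the candidate is
  accepted outright. Copying through array 4 puts the rows back in the order of the input.\<close>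

definition keep_if_better :: com where
  "keep_if_better =
     If (BNot (BAnd (NLess (NConst 0) (scalar 6)) (BNot (RLess (RGet 6 (NConst 0)) (RGet 8 (NConst 0))))))
       (Seq (copy_rows 8 9 (NMul l_exp n_exp) d_exp 1 (NGet 4 (scalar 8)) 5 0 (scalar 8))
            (RSet 8 (NConst 0) (RGet 6 (NConst 0))))
       Skip"

definition fair_program :: "com \<Rightarrow> com \<Rightarrow> com" where
  "fair_program U M =
     Seq sort_colors (Seq (Seq gather_rows write_header)
       (For 6 l_exp (Seq (make_candidate U M) (Seq evaluate_candidate keep_if_better))))"

text \<open>The position that \<open>sort_colors\<close> assigns to row \<open>x\<close>.\<close>

definition color_rank :: "nat \<Rightarrow> (nat \<Rightarrow> nat) \<Rightarrow> nat \<Rightarrow> nat" where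
  "color_rank n c x = c x * n + card {y. y < x \<and> c y = c x}"

section \<open>Counting sort by color\<close>

lemma card_earlier_less:
  assumes "balanced_coloring l n c" "x < l * n"
  shows "card {y. y < x \<and> c y = c x} < n"
proof -
  have cx: "c x < l" using assms by (auto simp: balanced_coloring_def)
  have "{y. y < x \<and> c y = c x} \<subset> {y. y < l * n \<and> c y = c x}"
    using assms(2) by auto
  then have "card {y. y < x \<and> c y = c x} < card {y. y < l * n \<and> c y = c x}"
    by (intro psubset_card_mono) auto
  then show ?thesis using assms(1) cx by (simp add: balanced_coloring_def)
qed

text \<open>The count inside a color stays below \<open>n\<close>, so the quotient of a rank by
  \<open>n\<close> is the color, and within one color the count grows strictly. An injective
  self-map of a finite set is a bijection.\<close>

lemma color_rank_bij:
  assumes "balanced_coloring l n c"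
  shows "bij_betw (color_rank n c) {..<l * n} {..<l * n}"
proof -
  have inj: "inj_on (color_rank n c) {..<l * n}"
  proof (rule linorder_inj_onI)
    fix x y assume xy: "x < y" "x \<in> {..<l * n}" "y \<in> {..<l * n}"
    show "color_rank n c x \<noteq> color_rank n c y"
    proof
      assume eq: "color_rank n c x = color_rank n c y"
      have less: "card {z. z < x \<and> c z = c x} < n" "card {z. z < y \<and> c z = c y} < n"
        using card_earlier_less[OF assms] xy by auto
      have "c x = c y" using arg_cong[OF eq, of "\<lambda>z. z div n"] less by (simp add: color_rank_def)
      then have "{z. z < x \<and> c z = c x} \<subset> {z. z < y \<and> c z = c y}" using xy by auto
      then have "card {z. z < x \<and> c z = c x} < card {z. z < y \<and> c z = c y}"
        by (intro psubset_card_mono) auto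
      then show False using eq \<open>c x = c y\<close> by (simp add: color_rank_def)
    qed
  qed auto
  moreover have "color_rank n c ` {..<l * n} \<subseteq> {..<l * n}"
  proof
    fix r assume "r \<in> color_rank n c ` {..<l * n}"
    then obtain x where x: "x < l * n" "r = color_rank n c x" by auto
    then have "c x < l" using assms by (auto simp: balanced_coloring_def)
    then show "r \<in> {..<l * n}"
      using block_index_less[OF _ card_earlier_less[OF assms x(1)]] x by (simp add: color_rank_def)
  qed
  ultimately show ?thesis
    by (simp add: bij_betw_def endo_inj_surj)
qed

text \<open>A left inverse of a permutation of the first \<open>l * n\<close> indices is its
  two-sided inverse there. Values at other indices are left open, so a whole memory array can serve
  as \<open>pos\<close>.\<close>

lemma color_sorting_of_rank_inverse:
  assumes bal: "balanced_coloring l n c" and "l \<ge> 1"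
    and inv: "\<And>x. x < l * n \<Longrightarrow> pos (color_rank n c x) = x"
  shows "color_sorting l n c pos"
proof
  have rank: "bij_betw (color_rank n c) {..<l * n} {..<l * n}" by (rule color_rank_bij[OF bal])
  have surj: "\<exists>x<l * n. r = color_rank n c x" if "r < l * n" for r
    using bij_betw_imp_surj_on[OF rank] that by (auto simp: set_eq_iff image_iff)
  show "bij_betw pos {..<l * n} {..<l * n}"
  proof (rule bij_betw_byWitness[where f' = "color_rank n c"])
    have "color_rank n c (pos r) = r \<and> pos r < l * n" if "r < l * n" for r
      using surj[OF that] inv by auto
    then show "\<forall>r\<in>{..<l * n}. color_rank n c (pos r) = r" "pos ` {..<l * n} \<subseteq> {..<l * n}" by auto
    show "color_rank n c ` {..<l * n} \<subseteq> {..<l * n}" using bij_betw_imp_surj_on[OF rank] by simp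
  qed (use inv in simp)
  fix a t assume at: "a < l" "t < n"
  then obtain x where x: "x < l * n" "a * n + t = color_rank n c x"
    using surj block_index_less by metis
  have "a = c x"
    using arg_cong[OF x(2), of "\<lambda>z. z div n"] at card_earlier_less[OF bal x(1)]
    by (simp add: color_rank_def)
  then show "c (pos (a * n + t)) = a" using x inv by simp
qed fact

lemma runs_sort_colors:
  assumes bal: "balanced_coloring l n c" and l: "l \<ge> 1"
    and s: "nats s 0 0 = l" "nats s 0 1 = n" "\<And>x. x < l * n \<Longrightarrow> nats s 0 (4 + x) = c x"
      "\<And>a. nats s 3 a = 0"
    and B: "real (l * n + 1) * 100 \<le> B"
    and Q: "\<And>s'. keeps {3, 4, 8} {} s s' \<Longrightarrow> color_sorting l n c (nats s' 4) \<Longrightarrow> Q s'"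
  shows "runs sort_colors s B Q"
  unfolding sort_colors_def
proof (rule runs_For[where N = "l * n" and b = 50 and
    I = "\<lambda>x s'. keeps {3, 4, 8} {} s s' \<and> (\<forall>a. nats s' 3 a = card {y. y < x \<and> c y = a}) \<and>
      (\<forall>y<x. nats s' 4 (color_rank n c y) = y)"], goal_cases)
  case 1
  then show ?case using s by (simp add: keeps_set_nat nats_set_nat)
next
  case (2 x s')
  then have K: "keeps {3, 4, 8} {} s s'" by blast
  have in0: "nats s' 0 = nats s 0" using K by (simp add: keeps_nats)
  have neq: "color_rank n c y \<noteq> color_rank n c x" if "y < x" for y
    using color_rank_bij[OF bal] that 2(1) by (auto simp: bij_betw_def inj_on_def)
  have cnt: "card {y. y < Suc x \<and> c y = a} = (if a = c x then Suc (card {y. y < x \<and> c y = a}) else card {y. y < x \<and> c y = a})" for a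
  proof -
    have "{y. y < Suc x \<and> c y = a} = (if a = c x then insert x {y. y < x \<and> c y = a} else {y. y < x \<and> c y = a})"
      by (auto simp: less_Suc_eq)
    then show ?thesis by simp
  qed
  show ?case
    apply (rule runs_Seq[OF runs_NSet[OF order_refl] order_refl[THEN order_trans]])
     apply (rule runs_NSet[OF order_refl])
    using 2 K s in0 neq cnt
    by (auto simp: keeps_set_nat nats_set_nat color_rank_def less_Suc_eq)
next
  case (3 x s')
  then have "nats s' 0 = nats s 0" by (intro keeps_nats[of "{3, 4, 8}" "{}"]) auto
  then show ?case using s by simp
next
  case 4
  have "real (l * n) * (50 + real (ncost (NMul l_exp n_exp)) + 10) + real (ncost (NMul l_exp n_exp)) + 7
      \<le> real (l * n + 1) * 100" by simp
  then show ?case using B by (rule order_trans)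
next
  case (5 s')
  then show ?case using color_sorting_of_rank_inverse[OF bal l] by (intro Q) auto
qed

section \<open>Correctness and running time\<close>

text \<open>One instance with a chosen halting run of \<open>U\<close> on every color class and of
  \<open>M\<close> on every pair, so that the candidates can be named independently of the program.
  \<open>X\<close> and \<open>Y\<close> stand for the time bounds; 5 and 4 count the scalars
  \<open>n, d, k, p, q\<close> and \<open>n, d, p, q\<close> of the two inputs.\<close>

locale fair_run = color_sorting +
  fixes U M :: com and k d :: nat and p q X Y :: real and A :: "real mat"
    and tU :: "nat \<Rightarrow> nat" and rU :: "nat \<Rightarrow> mem"
    and tM :: "nat \<Rightarrow> nat \<Rightarrow> nat" and rM :: "nat \<Rightarrow> nat \<Rightarrow> mem"
  assumes n_pos: "n \<ge> 1" and d_pos: "d \<ge> 1" and A: "A \<in> carrier_mat (l * n) d"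
    and U_exec: "\<And>i. i < l \<Longrightarrow>
      exec U (load [n, d, k] ([p, q] @ encode_mat (color_class A pos n i))) (tU i) (rU i)"
    and U_time: "\<And>i. i < l \<Longrightarrow> 5 + real (n * d) + real (tU i) \<le> X"
    and M_exec: "\<And>i j. i < l \<Longrightarrow> j < l \<Longrightarrow>
      exec M (load [n, d] ([p, q] @ encode_mat (color_class A pos n i) @ encode_mat (color_class A pos n j)))
        (tM i j) (rM i j)"
    and M_time: "\<And>i j. i < l \<Longrightarrow> j < l \<Longrightarrow> 4 + 2 * real (n * d) + real (tM i j) \<le> Y"
    and M_matching: "\<And>i j. i < l \<Longrightarrow> j < l \<Longrightarrow> nat_output (rM i j) \<in> perfect_matchings n"
begin

lemma matching_bij: "i < l \<Longrightarrow> j < l \<Longrightarrow> bij_betw (nat_output (rM i j)) {..<n} {..<n}"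
  using M_matching by (simp add: perfect_matchings_def)

lemma matching_less: "i < l \<Longrightarrow> j < l \<Longrightarrow> t < n \<Longrightarrow> nat_output (rM i j) t < n"
  using matching_bij[of i j] by (auto simp: bij_betw_def)

text \<open>Reading the inputs forces \<open>X\<close> \<ge> 5 and \<open>Y\<close> \<ge> 4, so the
  product dominates both factors and the size of a color class. From here on \<open>X * Y\<close> is
  the unit of time.\<close>

lemma time_bounds:
  shows "real (n * d) \<le> X * Y" "1 \<le> X * Y" "real n \<le> X * Y"
    and "i < l \<Longrightarrow> real (tU i) \<le> X * Y" "i < l \<Longrightarrow> j < l \<Longrightarrow> real (tM i j) \<le> X * Y"
proof -
  have l0: "0 < l" and nd: "0 \<le> real (n * d)" using l_pos by auto
  have X: "real (n * d) \<le> X" "5 \<le> X" using U_time[OF l0] nd by linarith+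
  have Y: "4 \<le> Y" using M_time[OF l0 l0] nd by linarith
  have XZ: "X \<le> X * Y" and YZ: "Y \<le> X * Y"
    using X Y mult_left_mono[of 1 Y X] mult_right_mono[of 1 X Y] by auto
  show 1: "real (n * d) \<le> X * Y" "1 \<le> X * Y" using X XZ by linarith+
  have "n \<le> n * d" using d_pos by simp
  then show "real n \<le> X * Y" using 1 of_nat_mono[of n "n * d", where 'a = real] by linarith
  show "real (tU i) \<le> X * Y" if "i < l" using U_time[OF that] XZ by linarith
  show "real (tM i j) \<le> X * Y" if "i < l" "j < l" using M_time[OF that] YZ by linarith
qed

text \<open>The state that every round of the main loop finds and leaves. Array 2 is fixed only in
  its header, because the color classes behind it are replaced again and again.\<close>

definition ready :: "mem \<Rightarrow> bool" where
  "ready s \<longleftrightarrow> nats s 0 0 = l \<and> nats s 0 1 = n \<and> nats s 0 2 = d \<and> nats s 4 = pos \<and>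
     nats s 2 0 = n \<and> nats s 2 1 = d \<and> nats s 2 2 = k \<and>
     reals s 0 0 = p \<and> reals s 0 1 = q \<and> reals s 2 0 = p \<and> reals s 2 1 = q \<and>
     (\<forall>x<l * n * d. reals s 3 x = A $$ (pos (x div d), x mod d))"

lemma ready_keeps:
  assumes "ready s" "keeps N R s s'" "N \<inter> {0, 2, 4} = {}" "R \<inter> {0, 3} = {}"
    and "reals s' 2 0 = reals s 2 0" "reals s' 2 1 = reals s 2 1"
  shows "ready s'"
proof -
  have "nats s' 0 = nats s 0" "nats s' 2 = nats s 2" "nats s' 4 = nats s 4"
    "reals s' 0 = reals s 0" "reals s' 3 = reals s 3"
    using assms(2-4) by (auto simp: keeps_def)
  then show ?thesis using assms by (simp add: ready_def)
qed

text \<open>In sorted row-major order a color class is a contiguous stretch of array 3, and copying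
  this stretch already yields the encoding that the subroutines expect.\<close>

lemma ready_color_class:
  assumes "ready s" "a < l" "x < n * d"
  shows "reals s 3 (a * (n * d) + x) = encode_mat (color_class A pos n a) ! x"
proof -
  have "a * (n * d) + x < l * (n * d)" using assms by (intro block_index_less)
  moreover have "(a * (n * d) + x) div d = a * n + x div d" "(a * (n * d) + x) mod d = x mod d"
    using d_pos by (simp_all flip: mult.assoc)
  ultimately show ?thesis
    using assms by (simp add: ready_def nth_encode_color_class[OF A] mult.assoc)
qed

lemma ready_row:
  assumes "ready s" "r < l * n" "e < d"
  shows "reals s 3 (r * d + e) = A $$ (pos r, e)"
  using assms block_index_less[of r "l * n" e d] by (simp add: ready_def)

lemma length_encode_color_class: "length (encode_mat (color_class A pos n a)) = n * d"
  by (rule length_encode_mat) (rule color_class_carrier[OF A])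

text \<open>The pivot class stays at the front of the buffer from one \<open>j\<close> to the next;
  only the second class is replaced. The last clause on array 5 confines the writes to the rows of
  color \<open>j\<close> and so protects the centers assigned to other colors.\<close>

lemma runs_match_color:
  assumes rd: "ready s" and i: "i < l" and j: "nats s 7 0 = j" "j < l"
    and buf: "\<And>x. x < n * d \<Longrightarrow> reals s 2 (2 + x) = encode_mat (color_class A pos n i) ! x"
    and Q: "\<And>s'. keeps {5, 8, 9} {2, 5, 9} s s' \<Longrightarrow> ready s' \<Longrightarrow>
      (\<And>x. x < n * d \<Longrightarrow> reals s' 2 (2 + x) = reals s 2 (2 + x)) \<Longrightarrow>
      (\<And>t e. t < n \<Longrightarrow> e < d \<Longrightarrow>
        reals s' 5 ((j * n + nat_output (rM i j) t) * d + e) = reals s 4 (t * d + e)) \<Longrightarrow>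
      (\<And>x. (\<And>t e. t < n \<Longrightarrow> e < d \<Longrightarrow> x \<noteq> (j * n + nat_output (rM i j) t) * d + e) \<Longrightarrow>
        reals s' 5 x = reals s 5 x) \<Longrightarrow> Q s'"
  shows "runs (match_color M) s (2000 * (X * Y)) Q"
  unfolding match_color_def
proof (rule runs_Seq[where ?B1.0 = "200 * (X * Y)"])
  show "runs (copy_range 9 2 (NAdd (NConst 2) block_exp) 3 (NMul (scalar 7) block_exp) block_exp) s (200 * (X * Y))
    (\<lambda>s1. runs (Seq (Call M 2 (NConst 2) 2 (NAdd (NConst 2) (NMul (NConst 2) block_exp)) 5 n_exp 9 (NConst 0))
       (copy_rows 8 9 n_exp d_exp 5 (NAdd (NMul (scalar 7) n_exp) (NGet 5 (scalar 8))) 4 0 (scalar 8))) s1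
     (1800 * (X * Y)) Q)"
  proof (rule runs_copy_range[where N = "n * d"], goal_cases)
    case 3
    then show ?case using rd by (simp add: ready_def)
  next
    case 4
    then show ?case using time_bounds(1,2) by simp
  next
    case (5 s1)
    have r1: "ready s1" using rd by (rule ready_keeps[OF _ 5(1)]) (auto intro: 5(3))
    have in1: "nats s1 0 0 = l" "nats s1 0 (Suc 0) = n" "nats s1 0 2 = d" "nats s1 2 0 = n" "nats s1 2 (Suc 0) = d"
      "reals s1 2 0 = p" "reals s1 2 (Suc 0) = q"
      using r1 by (auto simp: ready_def)
    have in0: "nats s 0 (Suc 0) = n" "nats s 0 2 = d" using rd by (auto simp: ready_def)
    have buf1: "reals s1 2 (2 + x) = reals s 2 (2 + x)" if "x < n * d" for x
      using that by (intro 5(3)) (simp add: in0)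
    have buf1': "reals s1 2 (2 + n * d + x) = encode_mat (color_class A pos n j) ! x" if "x < n * d" for x
      using 5(2)[OF that] that ready_color_class[OF rd j(2) that] by (simp add: in0 j)
    have reals_in: "map (reals s1 2) [0..<2 + 2 * (n * d)] =
        [p, q] @ encode_mat (color_class A pos n i) @ encode_mat (color_class A pos n j)"
    proof (rule nth_equalityI)
      fix x assume "x < length (map (reals s1 2) [0..<2 + 2 * (n * d)])"
      then have x: "x < 2 + 2 * (n * d)" by simp
      consider "x = 0" | "x = 1" | y where "x = 2 + y" "y < n * d" | y where "x = 2 + n * d + y" "y < n * d"
      proof -
        assume a: "x = 0 \<Longrightarrow> thesis" "x = 1 \<Longrightarrow> thesis"
          "\<And>y. x = 2 + y \<Longrightarrow> y < n * d \<Longrightarrow> thesis" "\<And>y. x = 2 + n * d + y \<Longrightarrow> y < n * d \<Longrightarrow> thesis"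
        show thesis
          using a(1,2) a(3)[of "x - 2"] a(4)[of "x - (2 + n * d)"] x by linarith
      qed
      then show "map (reals s1 2) [0..<2 + 2 * (n * d)] ! x =
          ([p, q] @ encode_mat (color_class A pos n i) @ encode_mat (color_class A pos n j)) ! x"
      proof cases
        case 3
        then show ?thesis using x buf[of y] buf1[of y]
          by (simp add: nth_append length_encode_color_class del: upt_Suc)
      next
        case 4
        then show ?thesis using x buf1'[OF 4(2)]
          by (simp add: nth_append length_encode_color_class add.assoc del: upt_Suc)
      qed (use x in1 in \<open>simp_all del: upt_Suc\<close>)
    qed (simp add: length_encode_color_class)
    have nats_in: "map (nats s1 2) [0..<2] = [n, d]"
      using in1 by (simp add: upt_conv_Cons)
    show ?case
    proof (rule runs_Seq[where ?B1.0 = "200 * (X * Y)" and ?B2.0 = "1600 * (X * Y)"])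
      let ?s2 = "copy_back 5 n 9 0 (rM i j) s1"
      have K2: "keeps {5, 8, 9} {2, 5, 9} s ?s2"
        using 5(1) by (simp add: keeps_def copy_back_def)
      have r2: "ready ?s2" using r1
        by (rule ready_keeps[where N = "{5}" and R = "{9}"]) (auto simp: keeps_def copy_back_def)
      have in2: "nats ?s2 0 (Suc 0) = n" "nats ?s2 0 2 = d" using r2 by (auto simp: ready_def)
      have "nats s1 7 = nats s 7" using 5(1) by (simp add: keeps_def)
      then have j2: "nats ?s2 7 0 = j" using j by (simp add: copy_back_def)
      have copy: "runs (copy_rows 8 9 n_exp d_exp 5 (NAdd (NMul (scalar 7) n_exp) (NGet 5 (scalar 8))) 4 0 (scalar 8))
          ?s2 (1600 * (X * Y)) Q"
      proof (rule runs_copy_rows[where N = n and d = d and F = "\<lambda>t. j * n + nat_output (rM i j) t" and G = "\<lambda>t. t"], goal_cases)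
        case (8 s' t)
        then have "nats s' 0 = nats ?s2 0" "nats s' 5 = nats ?s2 5" "nats s' 7 = nats ?s2 7"
          by (auto simp: keeps_def)
        then show ?case using 8 in2 j2 by (simp add: copy_back_def)
      next
        case 10
        show ?case using matching_bij[OF i j(2)] by (auto simp: bij_betw_def inj_on_def)
      next
        case 11
        show ?case using time_bounds(1,2) by simp
      next
        case (12 s')
        have K: "keeps {5, 8, 9} {2, 5, 9} s s'"
          using keeps_trans[OF K2] keeps_mono[OF 12(1)] by auto
        have same2: "reals s' 2 = reals s1 2" using keeps_reals[OF 12(1), of 2] by (simp add: copy_back_def)
        have "reals ?s2 4 = reals s 4" using 5(1) by (simp add: keeps_def copy_back_def)
        moreover have "reals ?s2 5 = reals s 5" using 5(1) by (simp add: keeps_def copy_back_def)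
        ultimately show ?case
          using 12 K buf1 same2 r2 by (intro Q) (auto intro: ready_keeps[OF r2 12(1)] simp: copy_back_def)
      qed (use in2 d_pos in auto)
      show "runs (Call M 2 (NConst 2) 2 (NAdd (NConst 2) (NMul (NConst 2) block_exp)) 5 n_exp 9 (NConst 0)) s1
        (200 * (X * Y)) (\<lambda>s2. runs (copy_rows 8 9 n_exp d_exp 5 (NAdd (NMul (scalar 7) n_exp) (NGet 5 (scalar 8))) 4 0 (scalar 8))
          s2 (1600 * (X * Y)) Q)"
      proof (rule runs_Call[where t = "tM i j" and r = "rM i j"], goal_cases)
        case 1
        then show ?case using M_exec[OF i j(2)] nats_in reals_in by (simp add: in1 del: upt_Suc)
      next
        case 2
        then show ?case using time_bounds(1,2,3) time_bounds(5)[OF i j(2)] by (simp add: in1)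
      next
        case 3
        then show ?case using copy by (simp add: in1)
      qed
    qed simp
  qed auto
qed simp

text \<open>Rows are taken in the order of colors; \<open>candidate_mat\<close> below restores the order of \<open>A\<close>.\<close>

definition candidate :: "nat \<Rightarrow> nat \<Rightarrow> nat \<Rightarrow> real" where
  "candidate i r e =
     real_output (rU i) (inv_into {..<n} (nat_output (rM i (r div n))) (r mod n) * d + e)"

lemma candidate_matched:
  assumes "i < l" "j < l" "t < n"
  shows "candidate i (j * n + nat_output (rM i j) t) e = real_output (rU i) (t * d + e)"
proof -
  have "inv_into {..<n} (nat_output (rM i j)) (nat_output (rM i j) t) = t"
    using matching_bij[OF assms(1,2)] assms(3) by (intro inv_into_f_f) (auto simp: bij_betw_def)
  then show ?thesis using matching_less[OF assms] by (simp add: candidate_def)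
qed

text \<open>Surjectivity of the matchings: the loop over the colors thus reaches every row of the
  candidate.\<close>

lemma matched_row:
  assumes "i < l" "r < l * n"
  obtains j t where "j < l" "t < n" "r = j * n + nat_output (rM i j) t"
proof -
  have j: "r div n < l" "r mod n < n" using assms n_pos by (auto simp: less_mult_imp_div_less)
  have "r mod n \<in> nat_output (rM i (r div n)) ` {..<n}"
    using bij_betw_imp_surj_on[OF matching_bij[OF assms(1) j(1)]] j by simp
  then obtain t where t: "t < n" "r mod n = nat_output (rM i (r div n)) t" by auto
  then have "r = r div n * n + nat_output (rM i (r div n)) t"
    by (metis div_mult_mod_eq)
  then show ?thesis by (rule that[OF j(1) t(1)])
qed

lemma runs_make_candidate:
  assumes rd: "ready s" and i: "nats s 6 0 = i" "i < l"
    and Q: "\<And>s'. keeps {5, 7, 8, 9, 10} {2, 4, 5, 9} s s' \<Longrightarrow> ready s' \<Longrightarrow>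
      (\<And>r e. r < l * n \<Longrightarrow> e < d \<Longrightarrow> reals s' 5 (r * d + e) = candidate i r e) \<Longrightarrow> Q s'"
  shows "runs (make_candidate U M) s (5000 * (real l * (X * Y))) Q"
proof -
  have lZ: "X * Y \<le> real l * (X * Y)"
    using mult_right_mono[of 1 "real l" "X * Y"] l_pos time_bounds(2) by simp
  show ?thesis
    unfolding make_candidate_def
  proof (rule runs_Seq[where ?B1.0 = "200 * (X * Y)"])
    show "runs (copy_range 9 2 (NConst 2) 3 (NMul (scalar 6) block_exp) block_exp) s (200 * (X * Y))
      (\<lambda>s1. runs (Seq (Call U 2 (NConst 3) 2 (NAdd (NConst 2) block_exp) 10 (NConst 0) 4 block_exp)
           (For 7 l_exp (match_color M))) s1 (4800 * (real l * (X * Y))) Q)"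
    proof (rule runs_copy_range[where N = "n * d"], goal_cases)
      case 3
      then show ?case using rd by (simp add: ready_def)
    next
      case 4
      then show ?case using time_bounds(1,2) by simp
    next
      case (5 s1)
      have r1: "ready s1" using rd by (rule ready_keeps[OF _ 5(1)]) (auto intro: 5(3))
      have in1: "nats s1 0 0 = l" "nats s1 0 (Suc 0) = n" "nats s1 0 2 = d" "nats s1 2 0 = n" "nats s1 2 (Suc 0) = d"
        "nats s1 2 2 = k" "reals s1 2 0 = p" "reals s1 2 (Suc 0) = q"
        using r1 by (auto simp: ready_def)
      have in0: "nats s 0 (Suc 0) = n" "nats s 0 2 = d" using rd by (auto simp: ready_def)
      have buf1: "reals s1 2 (2 + x) = encode_mat (color_class A pos n i) ! x" if "x < n * d" for x
        using 5(2)[OF that] that ready_color_class[OF rd i(2) that] by (simp add: in0 i)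
      have reals_in: "map (reals s1 2) [0..<2 + n * d] = [p, q] @ encode_mat (color_class A pos n i)"
      proof (rule nth_equalityI)
        fix x assume "x < length (map (reals s1 2) [0..<2 + n * d])"
        then have x: "x < 2 + n * d" by simp
        consider "x = 0" | "x = 1" | y where "x = 2 + y" "y < n * d"
        proof -
          assume a: "x = 0 \<Longrightarrow> thesis" "x = 1 \<Longrightarrow> thesis" "\<And>y. x = 2 + y \<Longrightarrow> y < n * d \<Longrightarrow> thesis"
          show thesis using a(1,2) a(3)[of "x - 2"] x by linarith
        qed
        then show "map (reals s1 2) [0..<2 + n * d] ! x = ([p, q] @ encode_mat (color_class A pos n i)) ! x"
        proof cases
          case 3
          then show ?thesis using x buf1[of y] by (simp add: nth_append del: upt_Suc)
        qed (use x in1 in \<open>simp_all del: upt_Suc\<close>)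
      qed (simp add: length_encode_color_class)
      have nats_in: "map (nats s1 2) [0..<3] = [n, d, k]"
        using in1 by (simp add: upt_conv_Cons numeral_2_eq_2)
      show ?case
      proof (rule runs_Seq[where ?B1.0 = "200 * (X * Y)" and ?B2.0 = "4600 * (real l * (X * Y))"])
        let ?s2 = "copy_back 10 0 4 (n * d) (rU i) s1"
        have K2: "keeps {5, 7, 8, 9, 10} {2, 4, 5, 9} s ?s2"
          using 5(1) by (simp add: keeps_def copy_back_def)
        have r2: "ready ?s2" using r1
          by (rule ready_keeps[where N = "{10}" and R = "{4}"]) (auto simp: keeps_def copy_back_def)
        have loop: "runs (For 7 l_exp (match_color M)) ?s2 (4600 * (real l * (X * Y))) Q"
        proof (rule runs_For[where N = l and b = "2000 * (X * Y)" and
            I = "\<lambda>j s'. keeps {5, 7, 8, 9, 10} {2, 4, 5, 9} s s' \<and> ready s' \<and>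
              (\<forall>x<n * d. reals s' 2 (2 + x) = encode_mat (color_class A pos n i) ! x) \<and>
              (\<forall>x<n * d. reals s' 4 x = real_output (rU i) x) \<and>
              (\<forall>j'<j. \<forall>t<n. \<forall>e<d. reals s' 5 ((j' * n + nat_output (rM i j') t) * d + e) =
                real_output (rU i) (t * d + e))"], goal_cases)
          case 1
          have "ready (set_nat 7 0 0 ?s2)" using r2
            by (rule ready_keeps[where N = "{7}" and R = "{}"]) (auto simp: keeps_set_nat)
          then show ?case using K2 buf1 by (simp add: keeps_set_nat) (simp add: copy_back_def)
        next
          case (2 j s')
          then have r': "ready s'" and buf': "\<And>x. x < n * d \<Longrightarrow> reals s' 2 (2 + x) = encode_mat (color_class A pos n i) ! x"
            and K': "keeps {5, 7, 8, 9, 10} {2, 4, 5, 9} s s'"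
            and C': "\<And>x. x < n * d \<Longrightarrow> reals s' 4 x = real_output (rU i) x"
            and old: "\<And>j' t e. j' < j \<Longrightarrow> t < n \<Longrightarrow> e < d \<Longrightarrow>
              reals s' 5 ((j' * n + nat_output (rM i j') t) * d + e) = real_output (rU i) (t * d + e)"
            by blast+
          show ?case
          proof (rule runs_match_color[OF r' i(2) 2(3) 2(1) buf'], goal_cases)
            case (2 s'')
            have rd'': "ready (set_nat 7 0 (Suc j) s'')" using 2(2)
              by (rule ready_keeps[where N = "{7}" and R = "{}"]) (auto simp: keeps_set_nat)
            have K'': "keeps {5, 7, 8, 9, 10} {2, 4, 5, 9} s s''"
              using keeps_trans[OF K'] keeps_mono[OF 2(1)] by auto
            have "nats s'' 7 = nats s' 7" "reals s'' 4 = reals s' 4"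
              using 2(1) by (auto simp: keeps_def)
            moreover have "reals s'' 5 ((j' * n + nat_output (rM i j') t) * d + e) = real_output (rU i) (t * d + e)"
              if "j' < Suc j" "t < n" "e < d" for j' t e
            proof (cases "j' = j")
              case True
              then show ?thesis using 2(4) that C' block_index_less[of t n e d] by simp
            next
              case False
              then have "j' < j" using that by simp
              \<comment> \<open>Division by \<open>d\<close> and then by \<open>n\<close> recovers
                the color from a cell, so the cells written for different colors are
                disjoint.\<close>
              have "(j' * n + nat_output (rM i j') t) * d + e \<noteq> (j * n + nat_output (rM i j) u) * d + e'"
                if "u < n" "e' < d" for u e'
              proof
                assume "(j' * n + nat_output (rM i j') t) * d + e = (j * n + nat_output (rM i j) u) * d + e'"
                then have "((j' * n + nat_output (rM i j') t) * d + e) div d div n =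
                  ((j * n + nat_output (rM i j) u) * d + e') div d div n" by simp
                then show False
                  using \<open>e < d\<close> that \<open>t < n\<close> matching_less[OF i(2)] \<open>j' < j\<close> \<open>j < l\<close> by simp
              qed
              then show ?thesis using old[OF \<open>j' < j\<close> \<open>t < n\<close> \<open>e < d\<close>] 2(5) by simp
            qed
            ultimately show ?case
              using rd'' K'' 2(3) buf' C' \<open>nats s' 7 0 = j\<close> by (simp add: keeps_set_nat)
          qed auto
        next
          case (3 j s')
          then show ?case by (simp add: ready_def)
        next
          case 4
          then show ?case using lZ mult_left_mono[OF time_bounds(2), of "real l"] time_bounds(2)
            by (simp add: algebra_simps)
        next
          case (5 s')
          then have K: "keeps {5, 7, 8, 9, 10} {2, 4, 5, 9} s s'" and rd': "ready s'"
            and cand: "\<And>j t e. j < l \<Longrightarrow> t < n \<Longrightarrow> e < d \<Longrightarrow>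
              reals s' 5 ((j * n + nat_output (rM i j) t) * d + e) = real_output (rU i) (t * d + e)"
            by blast+
          show ?case
          proof (rule Q[OF K rd'])
            fix r e assume "r < l * n" "e < d"
            then obtain j t where "j < l" "t < n" "r = j * n + nat_output (rM i j) t"
              by (elim matched_row[OF i(2)])
            then show "reals s' 5 (r * d + e) = candidate i r e"
              using cand candidate_matched i(2) \<open>e < d\<close> by simp
          qed
        qed
        show "runs (Call U 2 (NConst 3) 2 (NAdd (NConst 2) block_exp) 10 (NConst 0) 4 block_exp) s1 (200 * (X * Y))
          (\<lambda>s2. runs (For 7 l_exp (match_color M)) s2 (4600 * (real l * (X * Y))) Q)"
        proof (rule runs_Call[where t = "tU i" and r = "rU i"], goal_cases)
          case 1
          then show ?case using U_exec[OF i(2)] nats_in reals_in by (simp add: in1 del: upt_Suc)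
        next
          case 2
          then show ?case using time_bounds(1,2,3) time_bounds(4)[OF i(2)] by (simp add: in1 algebra_simps)
        next
          case 3
          then show ?case using loop by (simp add: in1)
        qed
      qed (use lZ in linarith)
    qed auto
  qed (use lZ in linarith)
qed

end

section \<open>Evaluating the candidates and keeping the best\<close>

context fair_run begin

text \<open>The sum runs over the sorted order, in which the program adds up, so that the loop
  invariants are its partial sums.\<close>

definition candidate_cost :: "nat \<Rightarrow> real" where
  "candidate_cost i =
     (\<Sum>r<l * n. (\<Sum>e<d. \<bar>A $$ (pos r, e) - candidate i r e\<bar> powr q) powr (p / q))"

lemma runs_evaluate_candidate:
  assumes rd: "ready s" and cand: "\<And>r e. r < l * n \<Longrightarrow> e < d \<Longrightarrow> reals s 5 (r * d + e) = candidate i r e"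
    and Q: "\<And>s'. keeps {8, 9} {6, 7} s s' \<Longrightarrow> ready s' \<Longrightarrow> reals s' 6 0 = candidate_cost i \<Longrightarrow> Q s'"
  shows "runs evaluate_candidate s (500 * (real l * (X * Y))) Q"
  unfolding evaluate_candidate_def
proof (rule runs_Seq[OF runs_RSet])
  let ?entry = "\<lambda>r e. \<bar>A $$ (pos r, e) - candidate i r e\<bar> powr q"
  let ?loop = "For 9 d_exp (RSet 7 (NConst 0) (RAdd (RGet 7 (NConst 0))
                (RPow (RAbs (RSub (RGet 3 (NAdd (NMul (scalar 8) d_exp) (scalar 9)))
                                  (RGet 5 (NAdd (NMul (scalar 8) d_exp) (scalar 9))))) q_exp)))"
  let ?add = "RSet 6 (NConst 0) (RAdd (RGet 6 (NConst 0)) (RPow (RGet 7 (NConst 0)) (RDiv p_exp q_exp)))"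
  have rdK: "ready s'" if "keeps {8, 9} {6, 7} s s'" for s'
    using that by (intro ready_keeps[OF rd that]) (auto simp: keeps_def)
  have candK: "reals s' 5 (r * d + e) = candidate i r e" if "keeps {8, 9} {6, 7} s s'" "r < l * n" "e < d" for s' r e
    using cand that by (simp add: keeps_def)
  show "runs (For 8 (NMul l_exp n_exp) (Seq (RSet 7 (NConst 0) (RNat (NConst 0))) (Seq ?loop ?add)))
     (set_real 6 (neval (NConst 0) s) (reval (RNat (NConst 0)) s) s) (490 * (real l * (X * Y))) Q"
  proof (rule runs_For[where N = "l * n" and b = "real (d + 1) * 80" and
      I = "\<lambda>r s'. keeps {8, 9} {6, 7} s s' \<and> reals s' 6 0 = (\<Sum>r<r. (\<Sum>e<d. ?entry r e) powr (p / q))"], goal_cases)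
    case 1
    then show ?case by (simp add: keeps_set_nat keeps_set_real reals_set_real)
  next
    case (2 r s')
    then have K: "keeps {8, 9} {6, 7} s s'" by blast
    show ?case
    proof (rule runs_Seq[OF runs_RSet[OF order_refl]])
      show "runs (Seq ?loop ?add) (set_real 7 (neval (NConst 0) s') (reval (RNat (NConst 0)) s') s')
        (real (d + 1) * 80 - 10) (\<lambda>s''. nats s'' 8 0 = r \<and> keeps {8, 9} {6, 7} s (set_nat 8 0 (Suc r) s'') \<and>
          reals (set_nat 8 0 (Suc r) s'') 6 0 = (\<Sum>r<Suc r. (\<Sum>e<d. ?entry r e) powr (p / q)))"
      proof (rule runs_Seq[where ?B1.0 = "real (d + 1) * 60" and ?B2.0 = 20], rule runs_For[where N = d and b = 40 and
          I = "\<lambda>m s''. keeps {8, 9} {6, 7} s s'' \<and> nats s'' 8 0 = r \<and> reals s'' 6 0 = reals s' 6 0 \<and>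
            reals s'' 7 0 = (\<Sum>e<m. ?entry r e)"], goal_cases)
        case 1
        then show ?case using K 2 by (simp add: keeps_set_nat keeps_set_real reals_set_real nats_set_nat)
      next
        case (2 m s'')
        then have K'': "keeps {8, 9} {6, 7} s s''" by blast
        have "reals s'' 3 (r * d + m) = A $$ (pos r, m)"
          using ready_row[OF rdK[OF K'']] \<open>r < l * n\<close> 2 by blast
        moreover have "reals s'' 5 (r * d + m) = candidate i r m"
          using candK[OF K''] \<open>r < l * n\<close> 2 by blast
        moreover have "nats s'' 0 2 = d" "reals s'' 0 (Suc 0) = q"
          using rdK[OF K''] by (auto simp: ready_def)
        ultimately show ?case
          using 2 by (intro runs_RSet) (auto simp: keeps_set_nat keeps_set_real reals_set_real nats_set_nat)
      next
        case (3 m s'')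
        then show ?case using rdK by (simp add: ready_def)
      next
        case 4
        then show ?case by simp
      next
        case (5 s'')
        then have K'': "keeps {8, 9} {6, 7} s s''" by blast
        have "reals s'' 0 0 = p" "reals s'' 0 (Suc 0) = q"
          using rdK[OF K''] by (auto simp: ready_def)
        then show ?case
          using 5 2 by (intro runs_RSet) (auto simp: keeps_set_nat keeps_set_real reals_set_real)
      next
        case 6
        then show ?case using d_pos by simp
      qed
    qed simp
  next
    case (3 r s')
    then show ?case using rdK by (simp add: ready_def)
  next
    case 4
    \<comment> \<open>The cost of the loop over \<open>n\<close> rows is
      \<open>80 * n * d + 95 * n\<close>, at most 175 times \<open>n * d\<close>; here 15 is the
      loop overhead per row.\<close>
    have "real n \<le> real (n * d)" using d_pos by (cases d) auto
    then have "real n * (real (d + 1) * 80 + 15) \<le> 175 * (X * Y)"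
      using time_bounds(1) by (simp add: algebra_simps)
    then have "real l * (real n * (real (d + 1) * 80 + 15)) \<le> real l * (175 * (X * Y))"
      by (rule mult_left_mono) simp
    moreover have "1 \<le> real l * (X * Y)"
      using mult_mono[of 1 "real l" 1 "X * Y"] l_pos time_bounds(2) by simp
    ultimately show ?case by (simp add: algebra_simps)
  next
    case (5 s')
    then show ?case using rdK by (intro Q) (auto simp: candidate_cost_def)
  qed
next
  have "1 \<le> real l * (X * Y)"
    using mult_mono[of 1 "real l" 1 "X * Y"] l_pos time_bounds(2) by simp
  then show "10 + 490 * (real l * (X * Y)) \<le> 500 * (real l * (X * Y))" by linarith
qed simp

text \<open>What is known about the best candidate depends on \<open>0 < i\<close>, as there is none
  in the first round. The new witness is \<open>i\<close> if the copy is made and \<open>b\<close>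
  otherwise.\<close>

lemma runs_keep_if_better:
  assumes rd: "ready s" and i: "nats s 6 0 = i" "i < l"
    and cand: "\<And>r e. r < l * n \<Longrightarrow> e < d \<Longrightarrow> reals s 5 (r * d + e) = candidate i r e"
    and cost: "reals s 6 0 = candidate_cost i"
    and best: "0 < i \<Longrightarrow> b < i \<and> reals s 8 0 = candidate_cost b \<and> (\<forall>j<i. candidate_cost b \<le> candidate_cost j) \<and>
      (\<forall>r<l * n. \<forall>e<d. reals s 1 (pos r * d + e) = candidate b r e)"
    and Q: "\<And>s' b'. keeps {8, 9} {1, 8} s s' \<Longrightarrow> ready s' \<Longrightarrow>
      b' < Suc i \<and> reals s' 8 0 = candidate_cost b' \<and> (\<forall>j<Suc i. candidate_cost b' \<le> candidate_cost j) \<and>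
      (\<forall>r<l * n. \<forall>e<d. reals s' 1 (pos r * d + e) = candidate b' r e) \<Longrightarrow> Q s'"
  shows "runs keep_if_better s (400 * (real l * (X * Y))) Q"
  unfolding keep_if_better_def
proof (rule runs_If[where ?B1.0 = "370 * (real l * (X * Y))"])
  have lZ: "1 \<le> real l * (X * Y)"
    using mult_mono[of 1 "real l" 1 "X * Y"] l_pos time_bounds(2) by simp
  show "1 + real (bcost (BNot (BAnd (NLess (NConst 0) (scalar 6)) (BNot (RLess (RGet 6 (NConst 0)) (RGet 8 (NConst 0)))))))
      + 370 * (real l * (X * Y)) \<le> 400 * (real l * (X * Y))" using lZ by (simp add: algebra_simps)
  have in0: "nats s 0 0 = l" "nats s 0 (Suc 0) = n" "nats s 0 2 = d" "nats s 4 = pos"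
    using rd by (auto simp: ready_def)
  {
    assume "beval (BNot (BAnd (NLess (NConst 0) (scalar 6)) (BNot (RLess (RGet 6 (NConst 0)) (RGet 8 (NConst 0)))))) s"
    then have new: "i = 0 \<or> candidate_cost i < reals s 8 0" using i cost by auto
    have less: "candidate_cost i \<le> candidate_cost j" if "j < Suc i" for j
      using new best that by (cases "j = i") (auto simp: less_Suc_eq intro: less_imp_le less_le_trans)
    show "runs (Seq (copy_rows 8 9 (NMul l_exp n_exp) d_exp 1 (NGet 4 (scalar 8)) 5 0 (scalar 8))
        (RSet 8 (NConst 0) (RGet 6 (NConst 0)))) s (370 * (real l * (X * Y))) Q"
    proof (rule runs_Seq[where ?B1.0 = "360 * (real l * (X * Y))" and ?B2.0 = 10])
      show "runs (copy_rows 8 9 (NMul l_exp n_exp) d_exp 1 (NGet 4 (scalar 8)) 5 0 (scalar 8)) s (360 * (real l * (X * Y)))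
        (\<lambda>s'. runs (RSet 8 (NConst 0) (RGet 6 (NConst 0))) s' 10 Q)"
      proof (rule runs_copy_rows[where N = "l * n" and d = d and F = pos and G = "\<lambda>r. r"], goal_cases)
        case (8 s' r)
        then show ?case using in0 by (simp add: keeps_def)
      next
        case 10
        show ?case using pos_bij by (simp add: bij_betw_def)
      next
        case 11
        have "real l * real (n * d) \<le> real l * (X * Y)" by (intro mult_left_mono time_bounds) simp
        then show ?case using lZ by (simp add: algebra_simps)
      next
        case (12 s')
        have eq: "reals s' 6 = reals s 6" using 12(1) by (simp add: keeps_def)
        have "keeps {8, 9} {1, 8} s (set_real 8 0 (reals s' 6 0) s')"
          using keeps_mono[OF 12(1)] by (auto intro: keeps_set_real)
        moreover have "ready (set_real 8 0 (reals s' 6 0) s')"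
          using rd calculation by (rule ready_keeps) (use 12(1) in \<open>auto simp: keeps_def reals_set_real\<close>)
        ultimately have "Q (set_real 8 0 (reals s' 6 0) s')"
          by (rule Q[of _ i]) (use 12(2) cand less cost eq in \<open>auto simp: reals_set_real\<close>)
        then show ?case by (intro runs_RSet) auto
      qed (use in0 d_pos in auto)
    qed (use lZ in linarith)
  next
    assume "\<not> beval (BNot (BAnd (NLess (NConst 0) (scalar 6)) (BNot (RLess (RGet 6 (NConst 0)) (RGet 8 (NConst 0)))))) s"
    then have "0 < i" "reals s 8 0 \<le> candidate_cost i" using i cost by auto
    then have "b < Suc i \<and> reals s 8 0 = candidate_cost b \<and> (\<forall>j<Suc i. candidate_cost b \<le> candidate_cost j) \<and>
      (\<forall>r<l * n. \<forall>e<d. reals s 1 (pos r * d + e) = candidate b r e)"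
      using best by (auto simp: less_Suc_eq)
    then have "Q s" by (intro Q[OF _ rd]) auto
    then show "runs Skip s (370 * (real l * (X * Y))) Q" using lZ by (intro runs_Skip) auto
  }
qed

text \<open>The square of \<open>l\<close> arises here: there are \<open>l\<close> rounds, and each
  of them calls \<open>M\<close> once for every color.\<close>

lemma runs_main_loop:
  assumes rd: "ready s"
    and Q: "\<And>s' b. b < l \<Longrightarrow> (\<And>i. i < l \<Longrightarrow> candidate_cost b \<le> candidate_cost i) \<Longrightarrow>
      (\<And>r e. r < l * n \<Longrightarrow> e < d \<Longrightarrow> reals s' 1 (pos r * d + e) = candidate b r e) \<Longrightarrow> Q s'"
  shows "runs (For 6 l_exp (Seq (make_candidate U M) (Seq evaluate_candidate keep_if_better))) s
    (6000 * ((real l)\<^sup>2 * (X * Y))) Q"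
proof -
  have lZ: "1 \<le> real l * (X * Y)" "real l \<le> real l * (X * Y)"
    using mult_mono[of 1 "real l" 1 "X * Y"] mult_left_mono[OF time_bounds(2), of "real l"] l_pos time_bounds(2)
    by simp_all
  then have llZ: "real l \<le> real l * (real l * (X * Y))" "real l * (X * Y) \<le> real l * (real l * (X * Y))"
    using l_pos mult_left_mono[OF lZ(1), of "real l"] mult_right_mono[of 1 "real l" "real l * (X * Y)"] by auto
  show ?thesis
  proof (rule runs_For[where N = l and b = "5900 * (real l * (X * Y))" and
      I = "\<lambda>i s'. ready s' \<and> (0 < i \<longrightarrow> (\<exists>b<i. reals s' 8 0 = candidate_cost b \<and>
        (\<forall>j<i. candidate_cost b \<le> candidate_cost j) \<and>
        (\<forall>r<l * n. \<forall>e<d. reals s' 1 (pos r * d + e) = candidate b r e)))"], goal_cases)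
    case 1
    have "ready (set_nat 6 0 0 s)" using rd
      by (rule ready_keeps[where N = "{6}" and R = "{}"]) (auto simp: keeps_set_nat)
    then show ?case by simp
  next
    case (2 i s')
    then have r': "ready s'" by blast
    obtain b where b: "0 < i \<Longrightarrow> b < i \<and> reals s' 8 0 = candidate_cost b \<and> (\<forall>j<i. candidate_cost b \<le> candidate_cost j) \<and>
        (\<forall>r<l * n. \<forall>e<d. reals s' 1 (pos r * d + e) = candidate b r e)"
      using 2(2) by blast
    show ?case
    proof (rule runs_Seq[where ?B1.0 = "5000 * (real l * (X * Y))" and ?B2.0 = "900 * (real l * (X * Y))"],
        rule runs_make_candidate[OF r' 2(3,1)],
        rule runs_Seq[where ?B1.0 = "500 * (real l * (X * Y))" and ?B2.0 = "400 * (real l * (X * Y))"],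
        rule runs_evaluate_candidate, assumption, assumption, goal_cases)
      case (1 s1 s2)
      have eq: "nats s2 6 = nats s' 6" "reals s2 1 = reals s' 1" "reals s2 8 = reals s' 8" "reals s2 5 = reals s1 5"
        using 1 by (auto simp: keeps_def)
      show ?case
      proof (rule runs_keep_if_better[where b = b and i = i, OF 1(5)], goal_cases)
        case (6 s3 b')
        have "nats s3 6 = nats s2 6" using 6(1) by (auto simp: keeps_def)
        moreover have "ready (set_nat 6 0 (Suc i) s3)" using 6(2)
          by (rule ready_keeps[where N = "{6}" and R = "{}"]) (auto simp: keeps_set_nat)
        ultimately show ?case using 6(3) 2(3) eq by auto
      qed (use 1 2 eq b in \<open>auto simp: ready_def\<close>)
    qed simp_all
  next
    case (3 i s')
    then show ?case by (simp add: ready_def)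
  next
    case 4
    then show ?case using lZ llZ by (simp add: algebra_simps power2_eq_square)
  next
    case (5 s')
    then obtain b where "b < l" "\<forall>j<l. candidate_cost b \<le> candidate_cost j"
        "\<forall>r<l * n. \<forall>e<d. reals s' 1 (pos r * d + e) = candidate b r e"
      using l_pos by auto
    then show ?case by (intro Q) auto
  qed
qed

lemma runs_gather_and_header:
  assumes in0: "nats s 0 0 = l" "nats s 0 1 = n" "nats s 0 2 = d" "nats s 0 3 = k" "nats s 4 = pos"
    and rs: "reals s 0 0 = p" "reals s 0 1 = q"
      "\<And>x. x < l * n * d \<Longrightarrow> reals s 0 (2 + x) = A $$ (x div d, x mod d)"
    and Q: "\<And>s'. ready s' \<Longrightarrow> Q s'"
  shows "runs (Seq gather_rows write_header) s (500 * (real l * (X * Y))) Q"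
proof (rule runs_Seq[where ?B1.0 = "400 * (real l * (X * Y))" and ?B2.0 = 100])
  have lZ: "1 \<le> real l * (X * Y)"
    using mult_mono[of 1 "real l" 1 "X * Y"] l_pos time_bounds(2) by simp
  then show "400 * (real l * (X * Y)) + 100 \<le> 500 * (real l * (X * Y))" by linarith
  show "runs gather_rows s (400 * (real l * (X * Y))) (\<lambda>s'. runs write_header s' 100 Q)"
    unfolding gather_rows_def
  proof (rule runs_copy_rows[where N = "l * n" and d = d and F = "\<lambda>r. r" and G = pos], goal_cases)
    case (9 s' r)
    then show ?case using in0 by (simp add: keeps_def)
  next
    case 11
    have "real l * real (n * d) \<le> real l * (X * Y)" by (intro mult_left_mono time_bounds) simp
    then show ?case using lZ by (simp add: algebra_simps)
  next
    case (12 s')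
    have eq: "nats s' 0 = nats s 0" "nats s' 4 = nats s 4" "reals s' 0 = reals s 0"
      using 12(1) by (auto simp: keeps_def)
    have sorted: "reals s' 3 x = A $$ (pos (x div d), x mod d)" if "x < l * n * d" for x
    proof -
      have x: "x div d < l * n" "x mod d < d" using that d_pos by (auto simp: less_mult_imp_div_less)
      then have "pos (x div d) < l * n" using pos_bij by (auto simp: bij_betw_def)
      then have "reals s 0 (2 + (pos (x div d) * d + x mod d)) = A $$ (pos (x div d), x mod d)"
        using rs(3)[OF block_index_less[OF _ x(2)]] x(2) by simp
      then show ?thesis using 12(2)[OF x] by (simp add: add.assoc)
    qed
    show ?case
      unfolding write_header_def
      apply (rule runs_Seq[OF runs_NSet[OF order_refl]], rule runs_Seq[OF runs_NSet[OF order_refl]],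
          rule runs_Seq[OF runs_NSet[OF order_refl]], rule runs_Seq[OF runs_RSet[OF order_refl]],
          rule runs_RSet[OF order_refl], rule Q)
      using in0 rs(1,2) sorted eq
      by (auto simp: ready_def nats_set_nat reals_set_real)
  qed (use in0 d_pos in auto)
qed

end

section \<open>From the final memory to the approximation guarantee\<close>

context fair_run begin

definition candidate_mat :: "nat \<Rightarrow> real mat" where
  "candidate_mat i = mat (l * n) d (\<lambda>(x, e). candidate i (inv_into {..<l * n} pos x) e)"

lemma candidate_mat_carrier: "candidate_mat i \<in> carrier_mat (l * n) d"
  by (simp add: candidate_mat_def)

lemma candidate_mat_pos:
  assumes "r < l * n" "e < d"
  shows "candidate_mat i $$ (pos r, e) = candidate i r e"
proof -
  have "pos r < l * n" using pos_bij assms(1) by (auto simp: bij_betw_def)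
  moreover have "inv_into {..<l * n} pos (pos r) = r"
    using pos_bij assms(1) by (intro inv_into_f_f) (auto simp: bij_betw_def)
  ultimately show ?thesis using assms by (simp add: candidate_mat_def)
qed

lemma cascaded_norm_candidate: "cascaded_norm p q (A - candidate_mat i) = candidate_cost i powr (1 / p)"
proof -
  let ?f = "\<lambda>x. (\<Sum>e<d. \<bar>A $$ (x, e) - candidate_mat i $$ (x, e)\<bar> powr q) powr (p / q)"
  have "cascaded_norm p q (A - candidate_mat i) = (\<Sum>x<l * n. ?f x) powr (1 / p)"
    using A candidate_mat_carrier[of i] by (simp add: cascaded_norm_def)
  also have "(\<Sum>x<l * n. ?f x) = (\<Sum>r<l * n. ?f (pos r))"
    by (rule sum.reindex_bij_betw[OF pos_bij, symmetric])
  also have "\<dots> = candidate_cost i"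
    by (simp add: candidate_cost_def candidate_mat_pos)
  finally show ?thesis .
qed

lemma decode_candidate:
  assumes "\<And>r e. r < l * n \<Longrightarrow> e < d \<Longrightarrow> g (pos r * d + e) = candidate i r e"
  shows "decode_mat (l * n) d g = candidate_mat i"
proof (rule eq_matI)
  fix x e assume "x < dim_row (candidate_mat i)" "e < dim_col (candidate_mat i)"
  then have x: "x < l * n" "e < d" by (simp_all add: candidate_mat_def)
  then have "x \<in> pos ` {..<l * n}" using bij_betw_imp_surj_on[OF pos_bij] by simp
  then obtain r where "r < l * n" "x = pos r" by auto
  then show "decode_mat (l * n) d g $$ (x, e) = candidate_mat i $$ (x, e)"
    using x assms by (simp add: decode_mat_def candidate_mat_pos)
qed (simp_all add: decode_mat_def candidate_mat_def)

text \<open>The program compares p-th powers of costs; since the power 1/p is monotone on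
  nonnegative numbers, its choice also has the least cost.\<close>

lemma approx_optimal_best_candidate:
  assumes "p \<ge> 1" "q \<ge> 1" "\<alpha> \<ge> 0"
    and "\<And>i. i < l \<Longrightarrow> approx_optimal \<alpha> (\<lambda>C. cascaded_norm p q (color_class A pos n i - C))
      (clusterings k n d) (decode_mat n d (real_output (rU i)))"
    and "\<And>i j. i < l \<Longrightarrow> j < l \<Longrightarrow>
      min_cost_matching n p q (color_class A pos n i) (color_class A pos n j) (nat_output (rM i j))"
    and "b < l" "\<And>i. i < l \<Longrightarrow> candidate_cost b \<le> candidate_cost i"
  shows "approx_optimal (\<alpha> + 2) (\<lambda>C. cascaded_norm p q (A - C)) (fair_clusterings k l n d c) (candidate_mat b)"
proof (rule best_transported_clustering[OF assms(1-3) A assms(4,5)])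
  fix i j t e assume "i < l" "j < l" "t < n" "e < d"
  then show "candidate_mat i $$ (pos (j * n + nat_output (rM i j) t), e) =
      decode_mat n d (real_output (rU i)) $$ (t, e)"
    using candidate_mat_pos[OF block_index_less[OF _ matching_less]] candidate_matched
    by (simp add: decode_mat_def)
next
  fix i assume "i < l"
  have "candidate_cost b \<ge> 0" by (simp add: candidate_cost_def sum_nonneg)
  then show "cascaded_norm p q (A - candidate_mat b) \<le> cascaded_norm p q (A - candidate_mat i)"
    unfolding cascaded_norm_candidate using assms(1,7) \<open>i < l\<close> by (intro powr_mono2) auto
qed (use assms(6) candidate_mat_carrier in auto)

end

text \<open>On \<open>k + 1\<close> distinct points every clustering has positive cost.\<close>

lemma approximation_factor_nonneg:
  assumes alg: "clustering_algorithm U \<alpha> k p q B" and "p \<ge> 1" "q \<ge> 1"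
  shows "\<alpha> \<ge> 0"
proof (rule ccontr)
  assume neg: "\<not> \<alpha> \<ge> 0"
  define A where "A = mat (Suc k) 1 (\<lambda>(i, j). real i)"
  have A: "A \<in> carrier_mat (Suc k) 1" by (simp add: A_def)
  have "\<forall>A\<in>carrier_mat (Suc k) 1. \<exists>r. approx_optimal \<alpha> (\<lambda>C. cascaded_norm p q (A - C))
      (clusterings k (Suc k) 1) (decode_mat (Suc k) 1 (real_output r))"
    using alg unfolding clustering_algorithm_def by (metis One_nat_def Suc_le_mono le0 le_refl)
  then obtain C where opt: "approx_optimal \<alpha> (\<lambda>C. cascaded_norm p q (A - C)) (clusterings k (Suc k) 1) C"
    using A by blast
  then have C: "C \<in> carrier_mat (Suc k) 1" "card (set (rows C)) \<le> k"
    by (auto simp: approx_optimal_def clusterings_def)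
  \<comment> \<open>With a nonnegative infimum, a negative factor forces the cost of
    \<open>C\<close> to be 0. Then \<open>C\<close> agrees with \<open>A\<close> and has too many
    distinct rows.\<close>
  have "0 \<le> (INF C\<in>clusterings k (Suc k) 1. cascaded_norm p q (A - C))"
    using opt by (intro cINF_greatest) (auto simp: approx_optimal_def cascaded_norm_def)
  then have "\<alpha> * (INF C\<in>clusterings k (Suc k) 1. cascaded_norm p q (A - C)) \<le> 0"
    using neg by (intro mult_nonpos_nonneg) auto
  then have "cascaded_norm p q (A - C) \<le> 0"
    using opt unfolding approx_optimal_def by linarith
  then have zero: "lp_norm p {..<Suc k} (\<lambda>i. row_dist q A i C i) = 0"
    using cascaded_norm_diff[OF assms(2,3) A C(1)] lp_norm_nonneg[of p "{..<Suc k}" "\<lambda>i. row_dist q A i C i"]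
    by linarith
  have entry: "C $$ (i, 0) = real i" if "i < Suc k" for i
  proof -
    have "row_dist q A i C i = 0"
      using lp_norm_eq_0[OF _ zero, of i] that by simp
    then have "A $$ (i, 0) - C $$ (i, 0) = 0"
      using lp_norm_eq_0[of "{..<dim_col A}" q "\<lambda>e. A $$ (i, e) - C $$ (i, e)" 0] A
      by (simp add: row_dist_def)
    then show ?thesis using that by (simp add: A_def)
  qed
  have "inj_on (row C) {0..<Suc k}"
  proof (rule inj_onI)
    fix i j assume ij: "i \<in> {0..<Suc k}" "j \<in> {0..<Suc k}" "row C i = row C j"
    have "C $$ (i, 0) = C $$ (j, 0)"
      using arg_cong[OF ij(3), of "\<lambda>v. v $ 0"] ij(1,2) C(1) by simp
    then show "i = j" using ij(1,2) entry by simp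
  qed
  then have "card (set (rows C)) = Suc k"
    using C(1) card_image[of "row C" "{0..<Suc k}"] by (simp add: rows_def del: upt_Suc)
  then show False using C(2) by simp
qed

lemma fair_program_correct:
  assumes U: "clustering_algorithm U \<alpha> k p q T" and M: "matching_algorithm M p q R"
    and pq: "p \<ge> 1" "q \<ge> 1"
    and l: "l \<ge> 1" and n: "n \<ge> 1" and d: "d \<ge> 1"
    and A: "A \<in> carrier_mat (l * n) d" and bal: "balanced_coloring l n c"
  shows "\<exists>r. halts_within (fair_program U M) ([l, n, d, k] @ map c [0..<l * n]) ([p, q] @ encode_mat A)
      (8000 * (real l)\<^sup>2 * R n d * T n d) r \<and>
    approx_optimal (\<alpha> + 2) (\<lambda>C. cascaded_norm p q (A - C)) (fair_clusterings k l n d c)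
      (decode_mat (l * n) d (real_output r))"
proof -
  let ?Z = "T n d * R n d"
  let ?s = "load ([l, n, d, k] @ map c [0..<l * n]) ([p, q] @ encode_mat A)"
  let ?ok = "\<lambda>r. approx_optimal (\<alpha> + 2) (\<lambda>C. cascaded_norm p q (A - C)) (fair_clusterings k l n d c)
      (decode_mat (l * n) d (real_output r))"
  have lenA: "length (encode_mat A) = l * n * d" by (rule length_encode_mat[OF A])
  \<comment> \<open>The runs are chosen for all matrices at once, because the color classes are
    determined only by the order that the sorting will leave in memory.\<close>
  have "\<forall>B\<in>carrier_mat n d. \<exists>t r. exec U (load [n, d, k] ([p, q] @ encode_mat B)) t r \<and>
      5 + real (n * d) + real t \<le> T n d \<and>
      approx_optimal \<alpha> (\<lambda>C. cascaded_norm p q (B - C)) (clusterings k n d) (decode_mat n d (real_output r))"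
  proof
    fix B :: "real mat" assume B: "B \<in> carrier_mat n d"
    then obtain r where r: "halts_within U [n, d, k] ([p, q] @ encode_mat B) (T n d) r"
        "approx_optimal \<alpha> (\<lambda>C. cascaded_norm p q (B - C)) (clusterings k n d) (decode_mat n d (real_output r))"
      using U n d unfolding clustering_algorithm_def by blast
    then show "\<exists>t r. exec U (load [n, d, k] ([p, q] @ encode_mat B)) t r \<and> 5 + real (n * d) + real t \<le> T n d \<and>
      approx_optimal \<alpha> (\<lambda>C. cascaded_norm p q (B - C)) (clusterings k n d) (decode_mat n d (real_output r))"
      unfolding halts_within_def using length_encode_mat[OF B] by (auto simp: add.assoc)
  qed
  then obtain tU rU where tU: "\<And>B. B \<in> carrier_mat n d \<Longrightarrow> exec U (load [n, d, k] ([p, q] @ encode_mat B)) (tU B) (rU B) \<and>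
      5 + real (n * d) + real (tU B) \<le> T n d \<and>
      approx_optimal \<alpha> (\<lambda>C. cascaded_norm p q (B - C)) (clusterings k n d) (decode_mat n d (real_output (rU B)))"
    by metis
  have "\<forall>V\<in>carrier_mat n d. \<forall>W\<in>carrier_mat n d. \<exists>t r.
      exec M (load [n, d] ([p, q] @ encode_mat V @ encode_mat W)) t r \<and>
      4 + 2 * real (n * d) + real t \<le> R n d \<and> min_cost_matching n p q V W (nat_output r)"
  proof (intro ballI)
    fix V W :: "real mat" assume V: "V \<in> carrier_mat n d" and W: "W \<in> carrier_mat n d"
    then obtain r where r: "halts_within M [n, d] ([p, q] @ encode_mat V @ encode_mat W) (R n d) r"
        "min_cost_matching n p q V W (nat_output r)"
      using M n d unfolding matching_algorithm_def by blast
    then show "\<exists>t r. exec M (load [n, d] ([p, q] @ encode_mat V @ encode_mat W)) t r \<and>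
      4 + 2 * real (n * d) + real t \<le> R n d \<and> min_cost_matching n p q V W (nat_output r)"
      unfolding halts_within_def using length_encode_mat[OF V] length_encode_mat[OF W] by (auto simp: algebra_simps)
  qed
  then obtain tM rM where tM: "\<And>V W. V \<in> carrier_mat n d \<Longrightarrow> W \<in> carrier_mat n d \<Longrightarrow>
      exec M (load [n, d] ([p, q] @ encode_mat V @ encode_mat W)) (tM V W) (rM V W) \<and>
      4 + 2 * real (n * d) + real (tM V W) \<le> R n d \<and> min_cost_matching n p q V W (nat_output (rM V W))"
    by metis
  have run: "fair_run l n c pos U M k d p q (T n d) (R n d) A
      (\<lambda>i. tU (color_class A pos n i)) (\<lambda>i. rU (color_class A pos n i))
      (\<lambda>i j. tM (color_class A pos n i) (color_class A pos n j))
      (\<lambda>i j. rM (color_class A pos n i) (color_class A pos n j))"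
    if "color_sorting l n c pos" for pos
    unfolding fair_run_def fair_run_axioms_def
    using that n d A tU tM color_class_carrier[OF A] by (simp add: min_cost_matching_def)

  \<comment> \<open>The zero matrix is a sample instance: a single run already shows that the bounds
    exceed the size of the input.\<close>
  have X: "5 \<le> T n d" "real (n * d) \<le> T n d" and Y: "1 \<le> R n d"
    using tU[OF zero_carrier_mat] tM[OF zero_carrier_mat zero_carrier_mat]
      of_nat_0_le_iff[of "n * d", where 'a = real] by linarith+
  then have Z: "1 \<le> ?Z" "real (n * d) \<le> ?Z"
    using mult_left_mono[of 1 "R n d" "T n d"] by linarith+
  have lZ: "1 \<le> real l * ?Z" "real (l * n * d) \<le> real l * ?Z" "real l * ?Z \<le> (real l)\<^sup>2 * ?Z"
  proof -
    show "real (l * n * d) \<le> real l * ?Z" using mult_left_mono[OF Z(2), of "real l"] by simp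
    show 1: "1 \<le> real l * ?Z" using mult_mono[of 1 "real l" 1 ?Z] l Z(1) by simp
    show "real l * ?Z \<le> (real l)\<^sup>2 * ?Z"
      using mult_right_mono[of 1 "real l" "real l * ?Z"] l 1 by (simp add: power2_eq_square)
  qed
  have ln: "real (l * n) \<le> real (l * n * d)" using d by (cases d) auto

  have "runs (fair_program U M) ?s (7000 * ((real l)\<^sup>2 * ?Z)) ?ok"
    unfolding fair_program_def
  proof (rule runs_Seq[where ?B1.0 = "200 * (real l * ?Z)" and ?B2.0 = "6500 * ((real l)\<^sup>2 * ?Z)"])
    show "runs sort_colors ?s (200 * (real l * ?Z)) (\<lambda>s1. runs (Seq (Seq gather_rows write_header)
       (For 6 l_exp (Seq (make_candidate U M) (Seq evaluate_candidate keep_if_better)))) s1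
       (6500 * ((real l)\<^sup>2 * ?Z)) ?ok)"
    proof (rule runs_sort_colors[OF bal l], goal_cases)
      case 5
      show ?case using ln lZ by simp
    next
      case (6 s1)
      \<comment> \<open>Only now is \<open>pos\<close> available: it is array 4 as left by the
        sorting.\<close>
      interpret fair_run l n c "nats s1 4" U M k d p q "T n d" "R n d" A
        "\<lambda>i. tU (color_class A (nats s1 4) n i)" "\<lambda>i. rU (color_class A (nats s1 4) n i)"
        "\<lambda>i j. tM (color_class A (nats s1 4) n i) (color_class A (nats s1 4) n j)"
        "\<lambda>i j. rM (color_class A (nats s1 4) n i) (color_class A (nats s1 4) n j)"
        by (rule run[OF 6(2)])
      have in1: "nats s1 0 = nats ?s 0" "reals s1 0 = reals ?s 0" using 6(1) by (auto simp: keeps_def)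
      show ?case
      proof (rule runs_Seq[where ?B1.0 = "500 * (real l * ?Z)" and ?B2.0 = "6000 * ((real l)\<^sup>2 * ?Z)"],
          rule runs_gather_and_header, goal_cases)
        case (8 x)
        then show ?case using nth_encode_mat[OF A 8] lenA in1 by (simp add: load_def)
      next
        case (9 s2)
        show ?case
        proof (rule runs_main_loop[OF 9])
          fix s' :: mem and b
          assume b: "b < l" "\<And>i. i < l \<Longrightarrow> candidate_cost b \<le> candidate_cost i"
            and out: "\<And>r e. r < l * n \<Longrightarrow> e < d \<Longrightarrow> reals s' 1 (nats s1 4 r * d + e) = candidate b r e"
          have decode: "decode_mat (l * n) d (real_output s') = candidate_mat b"
            by (rule decode_candidate) (rule out)
          show "?ok s'"
            unfolding decode
            using approximation_factor_nonneg[OF U pq] pq tU tM color_class_carrier[OF A] b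
            by (intro approx_optimal_best_candidate) auto
        qed
      next
        case 10
        show ?case using lZ by linarith
      qed (use in1 in \<open>auto simp: load_def\<close>)
    qed (auto simp: load_def nth_append)
    show "200 * (real l * ?Z) + 6500 * ((real l)\<^sup>2 * ?Z) \<le> 7000 * ((real l)\<^sup>2 * ?Z)"
      using lZ by linarith
  qed
  then obtain t r where tr: "exec (fair_program U M) ?s t r" "real t \<le> 7000 * ((real l)\<^sup>2 * ?Z)" "?ok r"
    unfolding runs_def by blast
  \<comment> \<open>\<open>halts_within\<close> also charges the reading of the input:
    \<open>4 + l * n\<close> naturals and \<open>2 + l * n * d\<close> reals. The step from 7000 to
    8000 covers this.\<close>
  have "real (length ([l, n, d, k] @ map c [0..<l * n]) + length ([p, q] @ encode_mat A) + t)
      = 6 + real (l * n) + real (l * n * d) + real t" by (simp add: lenA)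
  also have "\<dots> \<le> 8000 * ((real l)\<^sup>2 * ?Z)" using tr(2) ln lZ by linarith
  also have "\<dots> = 8000 * (real l)\<^sup>2 * R n d * T n d" by simp
  finally show ?thesis using tr unfolding halts_within_def by blast
qed

text \<open>The program reads \<open>k\<close>, \<open>p\<close> and \<open>q\<close> from its
  input, and \<alpha> enters only the analysis; so one program and one constant serve all
  parameters.\<close>

theorem theorem2:
  fixes U M :: com
    and T :: "nat \<Rightarrow> nat \<Rightarrow> nat \<Rightarrow> real \<Rightarrow> real \<Rightarrow> real"
    and MCPM :: "nat \<Rightarrow> nat \<Rightarrow> real \<Rightarrow> real \<Rightarrow> real"
  shows "\<exists>F :: com. \<exists>K :: real. K > 0 \<and>
    (\<forall>(k :: nat) (p :: real) (q :: real) (\<alpha> :: real).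
       k \<ge> 1 \<longrightarrow> p \<ge> 1 \<longrightarrow> q \<ge> 1 \<longrightarrow>
       clustering_algorithm U \<alpha> k p q (\<lambda>n d. T n d k p q) \<longrightarrow>
       matching_algorithm M p q (\<lambda>n d. MCPM n d p q) \<longrightarrow>
       fair_clustering_algorithm F (\<alpha> + 2) k p q
         (\<lambda>l n d. K * real l ^ 2 * MCPM n d p q * T n d k p q))"
proof (intro exI[of _ "fair_program U M"] exI[of _ 8000] conjI allI impI)
  fix k :: nat and p q \<alpha> :: real
  assume "k \<ge> 1" "p \<ge> 1" "q \<ge> 1"
    "clustering_algorithm U \<alpha> k p q (\<lambda>n d. T n d k p q)" "matching_algorithm M p q (\<lambda>n d. MCPM n d p q)"
  then show "fair_clustering_algorithm (fair_program U M) (\<alpha> + 2) k p q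
      (\<lambda>l n d. 8000 * real l ^ 2 * MCPM n d p q * T n d k p q)"
    unfolding fair_clustering_algorithm_def by (intro allI ballI impI) (rule fair_program_correct)
qed simp

end
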